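(* Let $k=k(n)\ge 1$ be integers with $k=n^{o(1)}$ as $n\to\infty$. Then the one-sided $k$-transposition shuffle $P_{n,k}$ on $S_n$ exhibits total variation cutoff at $t=n\log n$.
   Context: For $1\le i_1,\dots,i_k\le j\le n$ write $(j;i_1,\dots,i_k):=(j\,i_k)\cdots(j\,i_1)\in S_n$, where $(j\,j)$ is the identity. The one-sided $k$-transposition shuffle is the random walk on $S_n$ driven by the probability distribution $$P_{n,k}(\tau)=\sum_{\substack{1\le i_1,\dots,i_k\le j\le n\\ \tau=(j;i_1,\dots,i_k)}}\frac{1}{nj^k};$$ its transition matrix, also denoted $P_{n,k}$, is $P_{n,k}(x,x\tau)=P_{n,k}(\tau)$. With $U$ the uniform measure on $S_n$, $d^{(n,k)}(t)=\frac12\sum_{y\in S_n}|P_{n,k}^t(\mathrm{id},y)-U(y)|$. $P_{n,k}$ exhibits (total variation) cutoff at time $t_{n,k}$ if there is a window $w_{n,k}=o(t_{n,k})$ such that $$\lim_{c\to\infty}\lim_{n\to\infty}d^{(n,k)}(t_{n,k}-cw_{n,k})=1\quad\text{and}\quad\lim_{c\to\infty}\lim_{n\to\infty}d^{(n,k)}(t_{n,k}+cw_{n,k})=0$$ (non-integer times being rounded to integers). $\log$ is the natural logarithm. *)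

theory Defs
  imports
    Complex_Main
    "HOL-Combinatorics.Permutations"
    "HOL-Library.Landau_Symbols"
begin

abbreviation Sym :: "nat \<Rightarrow> (nat \<Rightarrow> nat) set" where
  "Sym n \<equiv> {p. p permutes {1..n}}"

text \<open>
  For \<open>is = [i\<^sub>1, \<dots>, i\<^sub>k]\<close> this is \<open>(j i\<^sub>k) \<circ> \<dots> \<circ> (j i\<^sub>1)\<close>, where the permutations
  are composed as functions.
\<close>

definition star_perm :: "nat \<Rightarrow> nat list \<Rightarrow> nat \<Rightarrow> nat" where
  "star_perm j is = fold (\<lambda>i \<tau>. transpose j i \<circ> \<tau>) is id"

definition shuffle_index :: "nat \<Rightarrow> nat \<Rightarrow> (nat \<times> nat list) set" where
  "shuffle_index n k = (SIGMA j:{1..n}. {is. set is \<subseteq> {1..j} \<and> length is = k})"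

definition shuffle_dist :: "nat \<Rightarrow> nat \<Rightarrow> (nat \<Rightarrow> nat) \<Rightarrow> real" where
  "shuffle_dist n k \<tau> =
     (\<Sum>(j, is) \<in> {(j, is) \<in> shuffle_index n k. \<tau> = star_perm j is}. 1 / (real n * real j ^ k))"

text \<open>The entry at \<open>(x, x \<circ> \<tau>)\<close> is the mass of \<open>\<tau>\<close>.\<close>

definition shuffle_matrix :: "nat \<Rightarrow> nat \<Rightarrow> (nat \<Rightarrow> nat) \<Rightarrow> (nat \<Rightarrow> nat) \<Rightarrow> real" where
  "shuffle_matrix n k x y = shuffle_dist n k (inv x \<circ> y)"

primrec matrix_power_on :: "'a set \<Rightarrow> ('a \<Rightarrow> 'a \<Rightarrow> real) \<Rightarrow> nat \<Rightarrow> 'a \<Rightarrow> 'a \<Rightarrow> real" where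
  "matrix_power_on S P 0 = (\<lambda>x y. if x = y then 1 else 0)"
| "matrix_power_on S P (Suc t) = (\<lambda>x y. \<Sum>z\<in>S. matrix_power_on S P t x z * P z y)"

definition shuffle_tv :: "nat \<Rightarrow> nat \<Rightarrow> nat \<Rightarrow> real" where
  "shuffle_tv n k t =
     (1 / 2) * (\<Sum>y\<in>Sym n.
        \<bar>matrix_power_on (Sym n) (shuffle_matrix n k) t id y - 1 / real (card (Sym n))\<bar>)"

text \<open>
  \<open>lim\<^bsub>c\<rightarrow>\<infinity>\<^esub> lim\<^bsub>n\<rightarrow>\<infinity>\<^esub> F c n = L\<close>, including the existence of the inner limits
  for all sufficiently large \<open>c\<close>.
\<close>

definition has_iterated_limit :: "(real \<Rightarrow> nat \<Rightarrow> real) \<Rightarrow> real \<Rightarrow> bool" where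
  "has_iterated_limit F L \<longleftrightarrow>
     (\<exists>l. (\<forall>\<^sub>F c in at_top. F c \<longlonglongrightarrow> l c) \<and> (l \<longlongrightarrow> L) at_top)"

text \<open>
  Times are rounded to the nearest integer. The truncation of negative times to 0 by
  \<^const>\<open>nat\<close> has no effect on the limits when \<open>t\<close> is eventually positive, as \<open>w\<close> is \<open>o(t)\<close>.
\<close>

definition exhibits_cutoff :: "(nat \<Rightarrow> nat \<Rightarrow> real) \<Rightarrow> (nat \<Rightarrow> real) \<Rightarrow> bool" where
  "exhibits_cutoff d t \<longleftrightarrow>
     (\<exists>w :: nat \<Rightarrow> real. (\<forall>n. 0 < w n) \<and> w \<in> o(t) \<and>
        has_iterated_limit (\<lambda>c n. d n (nat (round (t n - c * w n)))) 1 \<and>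
        has_iterated_limit (\<lambda>c n. d n (nat (round (t n + c * w n)))) 0)"

lemma star_perm_permutes:
  assumes "j \<in> {1..n}" "set is \<subseteq> {1..j}"
  shows "star_perm j is permutes {1..n}"
proof -
  have "fold (\<lambda>i \<tau>. transpose j i \<circ> \<tau>) is p permutes {1..n}"
    if "p permutes {1..n}" for p
    using assms that
  proof (induction "is" arbitrary: p)
    case (Cons i "is")
    have "transpose j i permutes {1..n}"
      using Cons.prems by (intro permutes_swap_id) auto
    then have "transpose j i \<circ> p permutes {1..n}"
      using Cons.prems by (blast intro: permutes_compose)
    with Cons.IH[OF Cons.prems(1)] Cons.prems(2) show ?case
      by (simp add: comp_def del: One_nat_def)
  qed simp
  then show ?thesis
    by (simp add: star_perm_def permutes_id del: One_nat_def)
qed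

lemma shuffle_dist_nonneg: "0 \<le> shuffle_dist n k \<tau>"
  unfolding shuffle_dist_def by (intro sum_nonneg) auto

lemma sum_shuffle_dist:
  assumes "1 \<le> n"
  shows "(\<Sum>\<tau>\<in>Sym n. shuffle_dist n k \<tau>) = 1"
proof -
  let ?w = "\<lambda>(j, is :: nat list). 1 / (real n * real j ^ k)"
  have fin: "finite (shuffle_index n k)"
    unfolding shuffle_index_def by (intro finite_SigmaI finite_lists_length_eq) auto
  have sub: "(\<lambda>(j, is). star_perm j is) ` shuffle_index n k \<subseteq> Sym n"
    unfolding shuffle_index_def using star_perm_permutes by fastforce
  have "(\<Sum>\<tau>\<in>Sym n. shuffle_dist n k \<tau>)
      = (\<Sum>\<tau>\<in>Sym n. sum ?w {x \<in> shuffle_index n k. (\<lambda>(j, is). star_perm j is) x = \<tau>})"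
    unfolding shuffle_dist_def by (intro sum.cong arg_cong2[where f = sum]) auto
  also have "\<dots> = sum ?w (shuffle_index n k)"
    using sum.group[OF fin _ sub, of ?w] by (simp add: finite_permutations)
  also have "\<dots> = (\<Sum>j\<in>{1..n}. \<Sum>is | set is \<subseteq> {1..j} \<and> length is = k. 1 / (real n * real j ^ k))"
    unfolding shuffle_index_def
    by (intro sum.Sigma[symmetric]) (auto simp: finite_lists_length_eq)
  also have "\<dots> = (\<Sum>j\<in>{1..n}. 1 / real n)"
    by (intro sum.cong) (auto simp: card_lists_length_eq)
  also have "\<dots> = 1"
    using assms by simp
  finally show ?thesis .
qed

end

theory Submission
  imports Defs "HOL-Real_Asymp.Real_Asymp"
begin

text \<open>
  With \<open>A\<^sub>j = (1/j) \<Sum>\<^bsub>i\<le>j\<^esub> (j i)\<close> in the group algebra, the walk is \<open>P = (1/n) \<Sum>\<^sub>j A\<^sub>j\<^sup>k\<close>, and the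
  \<open>A\<^sub>j\<close> commute. Expanding \<open>P\<^sup>t\<close> over the sequence of chosen \<open>j\<close>'s, every sequence that covers
  \<open>{1..n}\<close> contributes exactly the uniform measure, because \<open>A\<^sub>1 \<cdots> A\<^sub>n\<close> is uniform. So the
  distance is at most the probability that a coupon collector has not finished by time \<open>t\<close>, for
  every \<open>k\<close>.

  For the lower bound, consider the last \<open>L \<approx> \<eta> n / (2k)\<close> positions: each of them is touched in a
  step with probability at most \<open>(1 + \<eta>) / n\<close>, and the events are nearly uncorrelated. By
  Chebyshev's inequality, up to time \<open>(1 - \<eta>) n log n\<close> at least about \<open>n powr \<eta>\<^sup>2 / k\<close> of them remain untouched,
  which tends to infinity as \<open>k = n\<^bsup>o(1)\<^esup>\<close>, while a uniform permutation has at most one fixed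
  point there on average.
\<close>

section \<open>Sums over lists of fixed length\<close>

definition lists_of :: "'a set \<Rightarrow> nat \<Rightarrow> 'a list set" where
  "lists_of A n = {xs. set xs \<subseteq> A \<and> length xs = n}"

lemma lists_of_0 [simp]: "lists_of A 0 = {[]}"
  by (auto simp: lists_of_def)

lemma finite_lists_of [intro, simp]: "finite A \<Longrightarrow> finite (lists_of A n)"
  unfolding lists_of_def by (rule finite_lists_length_eq)

lemma card_lists_of [simp]: "finite A \<Longrightarrow> card (lists_of A n) = card A ^ n"
  unfolding lists_of_def by (rule card_lists_length_eq)

lemma sum_lists_of_Suc:
  fixes g :: "'a list \<Rightarrow> 'b::comm_monoid_add"
  shows "sum g (lists_of A (Suc n)) = (\<Sum>a\<in>A. \<Sum>xs\<in>lists_of A n. g (a # xs))"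
proof -
  have "sum g (lists_of A (Suc n)) = (\<Sum>(xs, a)\<in>lists_of A n \<times> A. g (a # xs))"
    unfolding lists_of_def lists_length_Suc_eq
    by (subst sum.reindex) (auto simp: inj_on_def case_prod_unfold intro!: sum.cong)
  also have "\<dots> = (\<Sum>xs\<in>lists_of A n. \<Sum>a\<in>A. g (a # xs))"
    by (simp add: sum.cartesian_product)
  also have "\<dots> = (\<Sum>a\<in>A. \<Sum>xs\<in>lists_of A n. g (a # xs))"
    by (rule sum.swap)
  finally show ?thesis .
qed

lemma sum_prod_list_lists_of:
  fixes c :: "'a \<Rightarrow> 'b::comm_semiring_1"
  shows "(\<Sum>xs\<in>lists_of A n. prod_list (map c xs)) = (\<Sum>a\<in>A. c a) ^ n"
  by (induction n) (simp_all add: sum_lists_of_Suc sum_distrib_right flip: sum_distrib_left)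

text \<open>The multinomial expansion for operators that need not commute: a word \<open>as\<close>
  stands for the composition whose head acts last. Linearity is required only over sums indexed by
  lists, as the induction pulls \<open>B a\<close> through the sum over shorter words.\<close>

lemma funpow_sum_operator:
  fixes B :: "'a \<Rightarrow> ('x \<Rightarrow> real) \<Rightarrow> 'x \<Rightarrow> real"
  assumes fin: "finite X"
    and lin: "\<And>a (I :: 'a list set) d g. a \<in> X \<Longrightarrow> finite I \<Longrightarrow>
      B a (\<lambda>x. \<Sum>i\<in>I. d i * g i x) = (\<lambda>x. \<Sum>i\<in>I. d i * B a (g i) x)"
  shows "((\<lambda>f x. \<Sum>a\<in>X. c a * B a f x) ^^ t) f
    = (\<lambda>x. \<Sum>as\<in>lists_of X t. prod_list (map c as) * foldr B as f x)"
proof (induction t)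
  case 0
  then show ?case by simp
next
  case (Suc t)
  have "((\<lambda>f x. \<Sum>a\<in>X. c a * B a f x) ^^ Suc t) f x
    = (\<Sum>as\<in>lists_of X (Suc t). prod_list (map c as) * foldr B as f x)" for x
    using fin
    by (simp add: Suc.IH lin sum_lists_of_Suc sum_distrib_left mult.assoc)
  then show ?case by blast
qed

section \<open>The walk as an averaging operator\<close>

definition index_weight :: "nat \<Rightarrow> nat \<Rightarrow> nat \<times> nat list \<Rightarrow> real" where
  "index_weight n k a = 1 / (real n * real (fst a) ^ k)"

definition index_perm :: "nat \<times> nat list \<Rightarrow> nat \<Rightarrow> nat" where
  "index_perm a = star_perm (fst a) (snd a)"

text \<open>The Markov operator of one step. It sums over the choices \<open>(j, is)\<close> rather
  than over permutations, so that the lower bound can see which positions a choice touches.\<close>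

definition shuffle_op :: "nat \<Rightarrow> nat \<Rightarrow> ((nat \<Rightarrow> nat) \<Rightarrow> real) \<Rightarrow> (nat \<Rightarrow> nat) \<Rightarrow> real" where
  "shuffle_op n k f x = (\<Sum>a\<in>shuffle_index n k. index_weight n k a * f (x \<circ> index_perm a))"

definition rand_swap :: "nat \<Rightarrow> ((nat \<Rightarrow> nat) \<Rightarrow> real) \<Rightarrow> (nat \<Rightarrow> nat) \<Rightarrow> real" where
  "rand_swap j f x = (\<Sum>i=1..j. f (x \<circ> transpose j i)) / real j"

text \<open>Averaging over the subgroup that permutes the first \<open>m\<close> points; for
  \<open>m = 0\<close> it is the identity, where the absorption argument starts.\<close>

definition unif_op :: "nat \<Rightarrow> ((nat \<Rightarrow> nat) \<Rightarrow> real) \<Rightarrow> (nat \<Rightarrow> nat) \<Rightarrow> real" where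
  "unif_op m f x = (\<Sum>\<sigma> | \<sigma> permutes {1..m}. f (x \<circ> \<sigma>)) / fact m"

lemma finite_shuffle_index: "finite (shuffle_index n k)"
  unfolding shuffle_index_def by (intro finite_SigmaI finite_lists_length_eq) auto

lemma index_perm_permutes: "a \<in> shuffle_index n k \<Longrightarrow> index_perm a permutes {1..n}"
  unfolding index_perm_def shuffle_index_def by (intro star_perm_permutes) auto

lemma sum_shuffle_index:
  "(\<Sum>a\<in>shuffle_index n k. index_weight n k a * g a)
    = (\<Sum>j=1..n. (\<Sum>is\<in>lists_of {1..j} k. g (j, is)) / real j ^ k) / real n"
proof -
  have "(\<Sum>a\<in>shuffle_index n k. index_weight n k a * g a)
    = (\<Sum>j=1..n. \<Sum>is\<in>lists_of {1..j} k. index_weight n k (j, is) * g (j, is))"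
    unfolding shuffle_index_def lists_of_def[symmetric]
    by (subst sum.Sigma) (auto simp: case_prod_unfold)
  then show ?thesis
    by (simp add: index_weight_def sum_divide_distrib divide_simps mult_ac)
qed

lemma sum_index_weight: "1 \<le> n \<Longrightarrow> (\<Sum>a\<in>shuffle_index n k. index_weight n k a) = 1"
  using sum_shuffle_index[of n k "\<lambda>_. 1"] by simp

text \<open>Substituting \<open>y = x \<circ> \<tau>\<close> turns the matrix entry into the mass of
  \<tau>, which is then split over the choices \<open>(j, is)\<close> producing \<tau>.\<close>

lemma sum_shuffle_matrix:
  assumes "x permutes {1..n}"
  shows "(\<Sum>y\<in>Sym n. shuffle_matrix n k x y * f y) = shuffle_op n k f x"
proof -
  have "(\<Sum>y\<in>Sym n. shuffle_matrix n k x y * f y)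
    = (\<Sum>\<tau>\<in>Sym n. shuffle_matrix n k x (x \<circ> \<tau>) * f (x \<circ> \<tau>))"
    by (rule setum_permutations_compose_left[OF assms])
  also have "\<dots> = (\<Sum>\<tau>\<in>Sym n. shuffle_dist n k \<tau> * f (x \<circ> \<tau>))"
    using permutes_inv_o(2)[OF assms] by (simp add: shuffle_matrix_def flip: comp_assoc)
  also have "\<dots> = (\<Sum>\<tau>\<in>Sym n. \<Sum>a\<in>{a\<in>shuffle_index n k. index_perm a = \<tau>}.
      index_weight n k a * f (x \<circ> index_perm a))"
    unfolding shuffle_dist_def sum_distrib_right
    by (intro sum.cong arg_cong2[where f = sum])
      (auto simp: index_perm_def index_weight_def)
  also have "\<dots> = shuffle_op n k f x"
    unfolding shuffle_op_def
    by (rule sum.group) (auto simp: finite_shuffle_index finite_permutations index_perm_permutes simp del: One_nat_def)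
  finally show ?thesis .
qed

text \<open>The entries of a matrix power are read off by taking \<open>f\<close> to be an
  indicator. The induction generalizes over \<open>f\<close>, because \<open>matrix_power_on\<close>
  adds its new factor on the right, where it acts on \<open>f\<close> first.\<close>

lemma sum_matrix_power:
  assumes "x permutes {1..n}"
  shows "(\<Sum>y\<in>Sym n. matrix_power_on (Sym n) (shuffle_matrix n k) t x y * f y)
    = (shuffle_op n k ^^ t) f x"
proof (induction t arbitrary: f)
  case 0
  have "(\<Sum>y\<in>Sym n. matrix_power_on (Sym n) (shuffle_matrix n k) 0 x y * f y)
    = (\<Sum>y\<in>Sym n. if x = y then f y else 0)"
    by (intro sum.cong) auto
  also have "\<dots> = f x"
    using assms finite_permutations[of "{1..n}"] by (subst sum.delta') auto
  finally show ?case by simp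
next
  case (Suc t)
  let ?M = "matrix_power_on (Sym n) (shuffle_matrix n k)"
  have "(\<Sum>y\<in>Sym n. ?M (Suc t) x y * f y)
    = (\<Sum>y\<in>Sym n. \<Sum>z\<in>Sym n. ?M t x z * (shuffle_matrix n k z y * f y))"
    by (simp add: sum_distrib_right mult.assoc)
  also have "\<dots> = (\<Sum>z\<in>Sym n. ?M t x z * (\<Sum>y\<in>Sym n. shuffle_matrix n k z y * f y))"
    by (subst sum.swap) (simp add: sum_distrib_left)
  also have "\<dots> = (\<Sum>z\<in>Sym n. ?M t x z * shuffle_op n k f z)"
    by (intro sum.cong refl) (simp add: sum_shuffle_matrix del: One_nat_def)
  also have "\<dots> = (shuffle_op n k ^^ t) (shuffle_op n k f) x"
    by (rule Suc.IH)
  finally show ?case by (simp only: funpow_Suc_right o_apply)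
qed

section \<open>Upper bound\<close>

lemma rand_swap_linear:
  "rand_swap j (\<lambda>x. \<Sum>i\<in>I. d i * g i x) = (\<lambda>x. \<Sum>i\<in>I. d i * rand_swap j (g i) x)"
proof
  fix x
  show "rand_swap j (\<lambda>x. \<Sum>i\<in>I. d i * g i x) x = (\<Sum>i\<in>I. d i * rand_swap j (g i) x)"
    unfolding rand_swap_def
    by (subst sum.swap) (simp add: sum_divide_distrib sum_distrib_left)
qed

lemma rand_swap_funpow_linear:
  "(rand_swap j ^^ k) (\<lambda>x. \<Sum>i\<in>I. d i * g i x) = (\<lambda>x. \<Sum>i\<in>I. d i * (rand_swap j ^^ k) (g i) x)"
  by (induction k) (simp_all add: rand_swap_linear)

lemma rand_swap_nonneg: "(\<And>x. 0 \<le> f x) \<Longrightarrow> 0 \<le> rand_swap j f x"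
  unfolding rand_swap_def by (intro divide_nonneg_nonneg sum_nonneg) auto

lemma rand_swap_funpow_nonneg: "(\<And>x. 0 \<le> f x) \<Longrightarrow> 0 \<le> (rand_swap j ^^ k) f x"
  by (induction k arbitrary: x) (simp_all add: rand_swap_nonneg)

text \<open>Every swap in the \<open>fold\<close> is multiplied on the left, so the starting value
  stays rightmost and the first index gives the rightmost factor.\<close>

lemma star_perm_Cons: "star_perm j (i # is) = star_perm j is \<circ> transpose j i"
proof -
  have "fold (\<lambda>i \<tau>. transpose j i \<circ> \<tau>) is p = fold (\<lambda>i \<tau>. transpose j i \<circ> \<tau>) is id \<circ> p" for p :: "nat \<Rightarrow> nat"
  proof (induction "is" arbitrary: p)
    case (Cons l "is")
    show ?case
      using Cons.IH[of "transpose j l \<circ> p"] Cons.IH[of "transpose j l"] by (simp add: comp_assoc)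
  qed simp
  from this[of "transpose j i"] show ?thesis by (simp add: star_perm_def)
qed

lemma rand_swap_funpow_eq:
  "(rand_swap j ^^ k) f x = (\<Sum>is\<in>lists_of {1..j} k. f (x \<circ> star_perm j is)) / real j ^ k"
proof (induction k arbitrary: f)
  case 0
  then show ?case by (simp add: star_perm_def)
next
  case (Suc k)
  \<comment> \<open>The innermost operator supplies the head of the list, since the first swap is
    the rightmost factor.\<close>
  have "(rand_swap j ^^ Suc k) f x = (rand_swap j ^^ k) (rand_swap j f) x"
    by (simp only: funpow_Suc_right o_apply)
  also have "\<dots> = (\<Sum>is\<in>lists_of {1..j} k. \<Sum>i=1..j. f (x \<circ> star_perm j (i # is))) / real j ^ Suc k"
    by (simp add: Suc.IH rand_swap_def star_perm_Cons o_def sum_divide_distrib mult_ac)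
  also have "\<dots> = (\<Sum>is\<in>lists_of {1..j} (Suc k). f (x \<circ> star_perm j is)) / real j ^ Suc k"
    by (simp only: sum_lists_of_Suc) (subst sum.swap, rule refl)
  finally show ?case .
qed

lemma shuffle_op_eq: "shuffle_op n k = (\<lambda>f x. \<Sum>j=1..n. 1 / real n * (rand_swap j ^^ k) f x)"
  unfolding shuffle_op_def sum_shuffle_index rand_swap_funpow_eq index_perm_def
  by (intro ext) (simp add: sum_divide_distrib)

text \<open>These are the Jucys--Murphy elements acting by right multiplication:
  \<open>(a i)\<close> with \<open>i \<le> a < b\<close> fixes \<open>b\<close> and permutes \<open>{1..b}\<close>, so conjugation by it only
  permutes the transpositions \<open>(b l)\<close>, \<open>l \<le> b\<close>.\<close>

lemma rand_swap_commute: "rand_swap a (rand_swap b f) = rand_swap b (rand_swap a f)"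
proof -
  have *: "rand_swap a (rand_swap b f) x = rand_swap b (rand_swap a f) x" if "a < b" for a b x
  proof -
    have "(\<Sum>l=1..b. f (x \<circ> transpose a i \<circ> transpose b l))
        = (\<Sum>l=1..b. f (x \<circ> transpose b l \<circ> transpose a i))" if "i \<in> {1..a}" for i
    proof -
      have p: "transpose a i permutes {1..b}"
        using that \<open>a < b\<close> by (intro permutes_swap_id) auto
      have b: "transpose a i b = b"
        using that \<open>a < b\<close> by (simp add: transpose_def)
      have "(\<Sum>l=1..b. f (x \<circ> transpose b l \<circ> transpose a i))
        = (\<Sum>l=1..b. f (x \<circ> transpose b (transpose a i l) \<circ> transpose a i))"
        using sum.permute[OF p, of "\<lambda>l. f (x \<circ> transpose b l \<circ> transpose a i)"]
        by (simp add: o_def)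
      also have "\<dots> = (\<Sum>l=1..b. f (x \<circ> transpose a i \<circ> transpose b l))"
      proof (intro sum.cong refl arg_cong[where f = f])
        fix l
        have "transpose a i \<circ> transpose b l = transpose b (transpose a i l) \<circ> transpose a i"
          using bij_swap_comp[of "transpose a i" b "transpose a i l"] b by simp
        then show "x \<circ> transpose b (transpose a i l) \<circ> transpose a i = x \<circ> transpose a i \<circ> transpose b l"
          by (simp add: comp_assoc)
      qed
      finally show ?thesis by simp
    qed
    then show ?thesis
      unfolding rand_swap_def sum_divide_distrib[symmetric]
      by (subst (2) sum.swap) (simp add: mult.commute)
  qed
  then show ?thesis
    by (metis linorder_neqE_nat ext)
qed

lemma rand_swap_funpow_commute:
  "(rand_swap a ^^ k) ((rand_swap b ^^ l) f) = (rand_swap b ^^ l) ((rand_swap a ^^ k) f)"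
proof -
  have *: "rand_swap a ((rand_swap b ^^ l) f) = (rand_swap b ^^ l) (rand_swap a f)" for f
    by (induction l) (simp_all add: rand_swap_commute[of a b])
  show ?thesis by (induction k) (simp_all add: *)
qed

section \<open>Absorption into averages over nested symmetric groups\<close>

lemma rand_swap_unif_op:
  assumes "1 \<le> j" "j \<le> m"
  shows "rand_swap j (unif_op m f) = unif_op m f"
proof
  fix x
  have "unif_op m f (x \<circ> transpose j i) = unif_op m f x" if "i \<in> {1..j}" for i
  proof -
    have "transpose j i permutes {1..m}"
      using that assms by (intro permutes_swap_id) auto
    \<comment> \<open>Translation by an element of the group only permutes the summands of the
      average.\<close>
    from setum_permutations_compose_left[OF this, of "\<lambda>\<sigma>. f (x \<circ> \<sigma>)"] show ?thesis
      by (simp add: unif_op_def comp_assoc)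
  qed
  then show "rand_swap j (unif_op m f) x = unif_op m f x"
    using assms by (simp add: rand_swap_def)
qed

text \<open>Every permutation of the first \<open>m + 1\<close> points is uniquely
  \<open>transpose (Suc m) i \<circ> \<sigma>\<close> with \<sigma> permuting the first
  \<open>m\<close>; this is one round of the Fisher-Yates shuffle.\<close>

lemma rand_swap_unif_op_Suc: "rand_swap (Suc m) (unif_op m f) = unif_op (Suc m) f"
proof
  fix x
  have "{1..Suc m} = insert (Suc m) {1..m}" by auto
  then have "(\<Sum>\<sigma> | \<sigma> permutes {1..Suc m}. f (x \<circ> \<sigma>))
    = (\<Sum>i=1..Suc m. \<Sum>\<sigma> | \<sigma> permutes {1..m}. f (x \<circ> (transpose (Suc m) i \<circ> \<sigma>)))"
    by (simp only:, subst sum_over_permutations_insert) auto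
  then show "rand_swap (Suc m) (unif_op m f) x = unif_op (Suc m) f x"
    by (simp add: rand_swap_def unif_op_def comp_assoc mult_ac flip: sum_divide_distrib del: sum.cl_ivl_Suc)
qed

lemma rand_swap_funpow_unif_op:
  "1 \<le> j \<Longrightarrow> j \<le> m \<Longrightarrow> (rand_swap j ^^ k) (unif_op m f) = unif_op m f"
  by (induction k) (simp_all add: rand_swap_unif_op)

lemma rand_swap_funpow_unif_op_Suc:
  assumes "1 \<le> k"
  shows "(rand_swap (Suc m) ^^ k) (unif_op m f) = unif_op (Suc m) f"
proof -
  obtain k' where "k = Suc k'" using assms by (cases k) auto
  then show ?thesis
    \<comment> \<open>One factor enlarges the group from \<open>m\<close> to \<open>m + 1\<close>
      points; the other \<open>k'\<close> factors fix the result.\<close>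
    by (simp only: funpow_Suc_right o_apply rand_swap_unif_op_Suc) (simp add: rand_swap_funpow_unif_op)
qed

text \<open>All factors commute, so one occurrence of \<open>j\<close> can be carried to the
  innermost place.\<close>

lemma foldr_rand_swap_remove1:
  assumes "j \<in> set js"
  shows "foldr (\<lambda>j. rand_swap j ^^ k) js f
    = foldr (\<lambda>j. rand_swap j ^^ k) (remove1 j js) ((rand_swap j ^^ k) f)"
proof -
  have *: "(rand_swap j ^^ k) (foldr (\<lambda>j. rand_swap j ^^ k) js f)
    = foldr (\<lambda>j. rand_swap j ^^ k) js ((rand_swap j ^^ k) f)" for js
  proof (induction js)
    case (Cons a js)
    then show ?case
      using rand_swap_funpow_commute[of k j k a "foldr (\<lambda>j. rand_swap j ^^ k) js f"]
      by (simp only: foldr.simps o_apply)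
  qed simp
  show ?thesis
    using assms
  proof (induction js)
    case (Cons a js)
    then show ?case
      by (cases "a = j") (simp_all add: *[symmetric])
  qed simp
qed

text \<open>The innermost function may be averaged over larger and larger groups: the factor of
  \<open>Suc m\<close> is brought inside, where it turns \<open>unif_op m\<close> into
  \<open>unif_op (Suc m)\<close>.\<close>

lemma foldr_rand_swap_absorb:
  assumes "1 \<le> k" "{1..m} \<subseteq> set js"
  shows "foldr (\<lambda>j. rand_swap j ^^ k) js f = foldr (\<lambda>j. rand_swap j ^^ k) js (unif_op m f)"
  using assms(2)
proof (induction m)
  case 0
  then show ?case by (simp add: unif_op_def)
next
  case (Suc m)
  have in_js: "Suc m \<in> set js" and "{1..m} \<subseteq> set js" using Suc.prems by auto
  have "foldr (\<lambda>j. rand_swap j ^^ k) js f = foldr (\<lambda>j. rand_swap j ^^ k) js (unif_op m f)"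
    using Suc.IH[OF \<open>{1..m} \<subseteq> set js\<close>] .
  also have "\<dots> = foldr (\<lambda>j. rand_swap j ^^ k) (remove1 (Suc m) js) (unif_op (Suc m) f)"
    unfolding foldr_rand_swap_remove1[OF in_js] rand_swap_funpow_unif_op_Suc[OF assms(1)] ..
  \<comment> \<open>The factor of \<open>Suc m\<close> fixes the new average, so it can be put back
    and the word \<open>js\<close> stays unchanged for the next round.\<close>
  also have "\<dots> = foldr (\<lambda>j. rand_swap j ^^ k) js (unif_op (Suc m) f)"
    unfolding foldr_rand_swap_remove1[OF in_js] by (simp add: rand_swap_funpow_unif_op)
  finally show ?case .
qed

text \<open>Absorption with \<open>m = n\<close> makes the innermost function the full average,
  which every factor leaves alone.\<close>

lemma foldr_rand_swap_eq_unif_op: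
  assumes "1 \<le> k" "set js = {1..n}"
  shows "foldr (\<lambda>j. rand_swap j ^^ k) js f = unif_op n f"
proof -
  have "set js \<subseteq> {1..n} \<Longrightarrow> foldr (\<lambda>j. rand_swap j ^^ k) js (unif_op n f) = unif_op n f" for js
    by (induction js) (auto simp: rand_swap_funpow_unif_op)
  with foldr_rand_swap_absorb[OF assms(1), of n js f] assms(2) show ?thesis by simp
qed

lemma foldr_rand_swap_nonneg:
  assumes "\<And>x. 0 \<le> f x"
  shows "0 \<le> foldr (\<lambda>j. rand_swap j ^^ k) js f x"
  using assms by (induction js arbitrary: x) (auto simp: rand_swap_funpow_nonneg)

section \<open>The coupon collector\<close>

lemma card_not_covering:
  assumes "1 \<le> n"
  shows "real (card {js \<in> lists_of {1..n} t. set js \<noteq> {1..n}}) \<le> real n * (real n - 1) ^ t"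
proof -
  \<comment> \<open>A word that misses some value lies in one of \<open>n\<close> sets of words over
    \<open>n - 1\<close> letters.\<close>
  have "{js \<in> lists_of {1..n} t. set js \<noteq> {1..n}} \<subseteq> (\<Union>j\<in>{1..n}. lists_of ({1..n} - {j}) t)"
    by (auto simp: lists_of_def)
  then have "card {js \<in> lists_of {1..n} t. set js \<noteq> {1..n}}
    \<le> card (\<Union>j\<in>{1..n}. lists_of ({1..n} - {j}) t)"
    by (intro card_mono) auto
  also have "\<dots> \<le> (\<Sum>j\<in>{1..n}. card (lists_of ({1..n} - {j}) t))"
    by (rule card_UN_le) simp
  also have "\<dots> = n * (n - 1) ^ t"
    by simp
  finally have "real (card {js \<in> lists_of {1..n} t. set js \<noteq> {1..n}}) \<le> real (n * (n - 1) ^ t)"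
    by (simp only: of_nat_le_iff)
  then show ?thesis using assms by (simp add: of_nat_diff)
qed

text \<open>Words that cover all of \<open>{1..n}\<close> contribute exactly
  \<open>unif_op n f x\<close>, and the rest contribute nonnegatively because \<open>f\<close> is
  nonnegative. The factor in front is the union bound for the share of covering words.\<close>

lemma shuffle_op_funpow_ge:
  assumes "1 \<le> n" "1 \<le> k" and f: "\<And>x. 0 \<le> f x"
  shows "(1 - real n * (1 - 1 / real n) ^ t) * unif_op n f x \<le> (shuffle_op n k ^^ t) f x"
proof -
  let ?C = "{js \<in> lists_of {1..n} t. set js = {1..n}}"
  let ?N = "{js \<in> lists_of {1..n} t. set js \<noteq> {1..n}}"
  let ?F = "\<lambda>js. foldr (\<lambda>j. rand_swap j ^^ k) js f x"
  have fin: "finite (lists_of {1..n} t)"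
    by auto
  have "card (lists_of {1..n} t) = card (?C \<union> ?N)"
    by (intro arg_cong[where f = card]) auto
  also have "\<dots> = card ?C + card ?N"
    using fin by (intro card_Un_disjoint) auto
  finally have "real n ^ t = real (card ?C) + real (card ?N)"
    by (simp flip: of_nat_add of_nat_power)
  then have "1 - real n * (1 - 1 / real n) ^ t \<le> real (card ?C) / real n ^ t"
  proof -
    have "real n * (1 - 1 / real n) ^ t = real n * (real n - 1) ^ t / real n ^ t"
      using assms(1) by (simp add: diff_divide_distrib[of "real n" 1 "real n"] flip: power_divide times_divide_eq_right)
    then have "1 - real n * (1 - 1 / real n) ^ t = (real n ^ t - real n * (real n - 1) ^ t) / real n ^ t"
      using assms(1) by (simp add: diff_divide_distrib)
    also have "\<dots> \<le> real (card ?C) / real n ^ t"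
      using card_not_covering[OF assms(1), of t] \<open>real n ^ t = _\<close>
      by (intro divide_right_mono) auto
    finally show ?thesis .
  qed
  moreover have "0 \<le> unif_op n f x"
    unfolding unif_op_def using f by (intro divide_nonneg_nonneg sum_nonneg) auto
  ultimately have "(1 - real n * (1 - 1 / real n) ^ t) * unif_op n f x
    \<le> real (card ?C) / real n ^ t * unif_op n f x"
    by (rule mult_right_mono)
  also have "\<dots> = (\<Sum>js\<in>?C. (1 / real n) ^ t * ?F js)"
  proof -
    have "(\<Sum>js\<in>?C. (1 / real n) ^ t * ?F js) = (\<Sum>js\<in>?C. (1 / real n) ^ t * unif_op n f x)"
    proof (rule sum.cong[OF refl])
      fix js assume "js \<in> ?C"
      then have "set js = {1..n}" by blast
      then show "(1 / real n) ^ t * ?F js = (1 / real n) ^ t * unif_op n f x"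
        by (simp only: foldr_rand_swap_eq_unif_op[OF assms(2)])
    qed
    then show ?thesis by (simp add: power_divide)
  qed
  also have "\<dots> \<le> (\<Sum>js\<in>lists_of {1..n} t. (1 / real n) ^ t * ?F js)"
    using fin foldr_rand_swap_nonneg[OF f] by (intro sum_mono2) auto
  also have "\<dots> = (\<Sum>js\<in>lists_of {1..n} t. prod_list (map (\<lambda>_. 1 / real n) js) * ?F js)"
    by (intro sum.cong) (auto simp: lists_of_def map_replicate_const)
  also have "\<dots> = (shuffle_op n k ^^ t) f x"
    unfolding shuffle_op_eq
    by (subst funpow_sum_operator) (auto simp: rand_swap_funpow_linear)
  finally show ?thesis .
qed

section \<open>Passage to total variation\<close>

lemma card_Sym: "card (Sym n) = fact n"
  by (rule card_permutations) auto

lemma sum_indicator_Sym: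
  assumes "y permutes {1..n}"
  shows "(\<Sum>z\<in>Sym n. g z * (if z = y then 1 else 0)) = (g y :: real)"
proof -
  have "(\<Sum>z\<in>Sym n. g z * (if z = y then 1 else 0)) = (\<Sum>z\<in>Sym n. if z = y then g z else 0)"
    by (intro sum.cong) auto
  then show ?thesis
    using assms finite_permutations[of "{1..n}"] by (simp del: One_nat_def)
qed

lemma matrix_power_ge:
  assumes "1 \<le> n" "1 \<le> k" "y permutes {1..n}"
  shows "(1 - real n * (1 - 1 / real n) ^ t) / fact n
    \<le> matrix_power_on (Sym n) (shuffle_matrix n k) t id y"
proof -
  let ?f = "\<lambda>z. if z = y then 1 else 0 :: real"
  have "unif_op n ?f id = 1 / fact n"
    using sum_indicator_Sym[OF assms(3), of "\<lambda>_. 1"] by (simp add: unif_op_def del: One_nat_def)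
  moreover have "(shuffle_op n k ^^ t) ?f id = matrix_power_on (Sym n) (shuffle_matrix n k) t id y"
    using sum_matrix_power[OF permutes_id, of n k t ?f] sum_indicator_Sym[OF assms(3)] by metis
  ultimately show ?thesis
    using shuffle_op_funpow_ge[OF assms(1,2), of ?f t id] by simp
qed

lemma sum_matrix_power_eq_1:
  assumes "1 \<le> n"
  shows "(\<Sum>y\<in>Sym n. matrix_power_on (Sym n) (shuffle_matrix n k) t id y) = 1"
proof -
  have "shuffle_op n k (\<lambda>_. 1) = (\<lambda>_. 1)"
    using sum_index_weight[OF assms, of k] unfolding shuffle_op_def by simp
  then have "(shuffle_op n k ^^ t) (\<lambda>_. 1) = (\<lambda>_. 1)"
    by (induction t) auto
  with sum_matrix_power[OF permutes_id, of n k t "\<lambda>_. 1"] show ?thesis by simp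
qed

theorem shuffle_tv_le:
  assumes "1 \<le> n" "1 \<le> k"
  shows "shuffle_tv n k t \<le> real n * (1 - 1 / real n) ^ t"
proof -
  let ?s = "real n * (1 - 1 / real n) ^ t"
  let ?M = "matrix_power_on (Sym n) (shuffle_matrix n k) t id"
  have s: "0 \<le> ?s" using assms by simp
  \<comment> \<open>An absolute value is the number itself plus twice its negative part, and here
    the negative part is at most \<open>?s / fact n\<close>. The numbers
    \<open>?M y - 1 / fact n\<close> sum to 0, so only the correction survives, with total
    \<open>2 * ?s\<close>.\<close>
  have "\<bar>?M y - 1 / fact n\<bar> \<le> ?M y - 1 / fact n + 2 * ?s / fact n" if "y \<in> Sym n" for y
  proof -
    have "0 \<le> ?s / fact n" using s by simp
    then show ?thesis
      using matrix_power_ge[OF assms, of y t] that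
      by (simp add: diff_divide_distrib abs_le_iff del: One_nat_def)
  qed
  then have "(\<Sum>y\<in>Sym n. \<bar>?M y - 1 / fact n\<bar>) \<le> (\<Sum>y\<in>Sym n. ?M y - 1 / fact n + 2 * ?s / fact n)"
    by (rule sum_mono)
  also have "\<dots> = 2 * ?s"
    using sum_matrix_power_eq_1[OF assms(1), of k t] card_Sym[of n]
    by (simp add: sum.distrib sum_subtractf del: One_nat_def)
  finally show ?thesis
    unfolding shuffle_tv_def card_Sym by simp
qed

section \<open>Lower bound\<close>

definition path_perm :: "(nat \<times> nat list) list \<Rightarrow> nat \<Rightarrow> nat" where
  "path_perm as = foldr (\<lambda>a p. index_perm a \<circ> p) as id"

definition path_weight :: "nat \<Rightarrow> nat \<Rightarrow> (nat \<times> nat list) list \<Rightarrow> real" where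
  "path_weight n k as = prod_list (map (index_weight n k) as)"

text \<open>Choosing \<open>j \<in> S\<close> counts as touching \<open>S\<close> even if the resulting permutation is the
  identity.\<close>

definition avoids :: "nat set \<Rightarrow> nat \<times> nat list \<Rightarrow> bool" where
  "avoids S a \<longleftrightarrow> fst a \<notin> S \<and> set (snd a) \<inter> S = {}"

definition avoid_prob :: "nat \<Rightarrow> nat \<Rightarrow> nat set \<Rightarrow> real" where
  "avoid_prob n k S = (\<Sum>a\<in>shuffle_index n k. index_weight n k a * of_bool (avoids S a))"

lemma index_weight_nonneg: "0 \<le> index_weight n k a"
  by (simp add: index_weight_def)

lemma path_weight_nonneg: "0 \<le> path_weight n k as"
  unfolding path_weight_def by (induction as) (simp_all add: index_weight_nonneg)

lemma sum_path_weight: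
  assumes "1 \<le> n"
  shows "(\<Sum>as\<in>lists_of (shuffle_index n k) t. path_weight n k as) = 1"
  unfolding path_weight_def sum_prod_list_lists_of sum_index_weight[OF assms] by simp

text \<open>The steps are independent: the indicator for the whole path is a product of indicators
  of its steps.\<close>

lemma sum_path_weight_avoids:
  "(\<Sum>as\<in>lists_of (shuffle_index n k) t. path_weight n k as * of_bool (\<forall>a\<in>set as. avoids S a))
    = avoid_prob n k S ^ t"
proof -
  have "path_weight n k as * of_bool (\<forall>a\<in>set as. avoids S a)
    = prod_list (map (\<lambda>a. index_weight n k a * of_bool (avoids S a)) as)" for as
    unfolding path_weight_def by (induction as) auto
  then show ?thesis
    by (simp only: sum_prod_list_lists_of avoid_prob_def)
qed

lemma shuffle_op_funpow_eq:
  "(shuffle_op n k ^^ t) f x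
    = (\<Sum>as\<in>lists_of (shuffle_index n k) t. path_weight n k as * f (x \<circ> path_perm as))"
proof -
  \<comment> \<open>Steps multiply on the right, so the head of the path is the leftmost factor of
    \<open>path_perm as\<close>, in line with the head operator being outermost.\<close>
  have foldr: "foldr (\<lambda>a f x. f (x \<circ> index_perm a)) as f x = f (x \<circ> path_perm as)" for as x
    by (induction as arbitrary: x) (simp_all add: path_perm_def comp_assoc)
  have "shuffle_op n k
    = (\<lambda>f x. \<Sum>a\<in>shuffle_index n k. index_weight n k a * (\<lambda>a f x. f (x \<circ> index_perm a)) a f x)"
    by (intro ext) (simp add: shuffle_op_def)
  then show ?thesis
    by (simp only:) (subst funpow_sum_operator, simp_all only: finite_shuffle_index foldr path_weight_def)
qed

lemma star_perm_fixes: "m \<noteq> j \<Longrightarrow> m \<notin> set is \<Longrightarrow> star_perm j is m = m"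
  by (induction "is") (simp_all add: star_perm_Cons transpose_def, simp add: star_perm_def)

lemma path_perm_fixes:
  assumes "\<forall>a\<in>set as. avoids {m} a"
  shows "path_perm as m = m"
  using assms
  by (induction as) (auto simp: path_perm_def avoids_def index_perm_def star_perm_fixes)

section \<open>Avoidance probabilities of one and two positions\<close>

lemma avoid_prob_eq:
  "avoid_prob n k S
    = (\<Sum>j=1..n. of_bool (j \<notin> S) * (real (card ({1..j} - S)) / real j) ^ k) / real n"
proof -
  have "(\<Sum>is\<in>lists_of {1..j} k. of_bool (avoids S (j, is)))
    = (of_bool (j \<notin> S) * real (card ({1..j} - S)) ^ k :: real)" for j
  proof (cases "j \<in> S")
    case False
    \<comment> \<open>Given \<open>j\<close> outside \<open>S\<close>, the \<open>k\<close> indices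
      are chosen independently, and each has to miss \<open>S\<close>.\<close>
    have "lists_of {1..j} k \<inter> {is. avoids S (j, is)} = lists_of ({1..j} - S) k"
      using False by (auto simp: avoids_def lists_of_def)
    then show ?thesis
      using False by (simp add: sum.If_cases of_bool_def)
  qed (simp add: avoids_def)
  then show ?thesis
    unfolding avoid_prob_def sum_shuffle_index by (simp add: power_divide)
qed

text \<open>The conditional probability, given \<open>j\<close>, that a step touches
  \<open>m\<close>; it vanishes for \<open>1 \<le> j < m\<close>, as only positions up to
  \<open>j\<close> are involved.\<close>

definition hit_prob :: "nat \<Rightarrow> nat \<Rightarrow> nat \<Rightarrow> real" where
  "hit_prob k m j = 1 - of_bool (j \<noteq> m) * (real (card ({1..j} - {m})) / real j) ^ k"

lemma hit_prob_bounds: "0 \<le> hit_prob k m j" "hit_prob k m j \<le> 1"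
proof -
  have "card ({1..j} - {m}) \<le> card {1..j}"
    by (intro card_mono) auto
  then show "0 \<le> hit_prob k m j"
    by (auto simp: hit_prob_def divide_le_eq_1 intro!: power_le_one)
  show "hit_prob k m j \<le> 1"
    by (simp add: hit_prob_def)
qed

lemma hit_prob_le:
  assumes "1 \<le> m" "1 \<le> j"
  shows "hit_prob k m j \<le> of_bool (j = m) + of_bool (m < j) * (real k / real j)"
proof -
  consider "j < m" | "j = m" | "m < j" by linarith
  then show ?thesis
  proof cases
    case 1
    then have "{1..j} - {m} = {1..j}" by auto
    then show ?thesis using 1 assms(2) by (simp add: hit_prob_def)
  next
    case 2
    then show ?thesis by (simp add: hit_prob_def)
  next
    case 3
    \<comment> \<open>Bernoulli's inequality plays the part of a union bound over the
      \<open>k\<close> indices, each equal to \<open>m\<close> with probability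
      \<open>1 / j\<close>.\<close>
    have "1 + real k * (- 1 / real j) \<le> (1 + (- 1 / real j)) ^ k"
      using 3 by (intro Bernoulli_inequality) auto
    moreover have "real (card ({1..j} - {m})) / real j = 1 + (- 1 / real j)"
      using 3 assms by (simp add: of_nat_diff field_simps)
    ultimately show ?thesis using 3 by (simp add: hit_prob_def)
  qed
qed

lemma avoid_prob_single:
  assumes "1 \<le> n"
  shows "avoid_prob n k {m} = 1 - (\<Sum>j=1..n. hit_prob k m j) / real n"
proof -
  have "avoid_prob n k {m} = (\<Sum>j=1..n. 1 - hit_prob k m j) / real n"
    by (simp add: avoid_prob_eq hit_prob_def)
  then show ?thesis
    using assms by (simp add: sum_subtractf diff_divide_distrib)
qed

text \<open>Given \<open>j\<close>, the joint avoidance probability is at most the product of the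
  single ones. Averaging over \<open>j\<close> couples the events again, at a cost of at most the
  mean of the product of the hit probabilities.\<close>

lemma avoid_prob_pair_le:
  assumes "1 \<le> n" "m \<noteq> m'"
  shows "avoid_prob n k {m, m'}
    \<le> avoid_prob n k {m} * avoid_prob n k {m'} + (\<Sum>j=1..n. hit_prob k m j * hit_prob k m' j) / real n"
proof -
  define A B C where
    "A = (\<Sum>j=1..n. hit_prob k m j)" "B = (\<Sum>j=1..n. hit_prob k m' j)"
    "C = (\<Sum>j=1..n. hit_prob k m j * hit_prob k m' j)"
  have "of_bool (j \<notin> {m, m'}) * (real (card ({1..j} - {m, m'})) / real j) ^ k
    \<le> (1 - hit_prob k m j) * (1 - hit_prob k m' j)" if "1 \<le> j" for j
  proof -
    define u v where "u = (of_bool (m \<in> {1..j}) :: real)" "v = (of_bool (m' \<in> {1..j}) :: real)"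
    have c: "real (card ({1..j} - {m})) = real j - u" "real (card ({1..j} - {m'})) = real j - v"
      using that by (auto simp: u_v_def card_Diff_singleton_if of_nat_diff)
    have c2: "real (card ({1..j} - {m, m'})) = real j - u - v"
    proof -
      have "card ({1..j} - {m, m'}) = card ({1..j} - {m} - {m'})"
        by (intro arg_cong[where f = card]) auto
      also have "real \<dots> = real (card ({1..j} - {m})) - v"
        using assms(2) by (auto simp: u_v_def card_Diff_singleton_if of_nat_diff card_gt_0_iff Suc_le_eq)
      finally show ?thesis by (simp only: c)
    qed
    \<comment> \<open>The right-hand side exceeds the left-hand side by
      \<open>u * v\<close>.\<close>
    have "(real j - u - v) * real j \<le> (real j - u) * (real j - v)"
      by (simp add: algebra_simps u_v_def)
    then have "real (card ({1..j} - {m, m'})) / real j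
      \<le> (real (card ({1..j} - {m})) / real j) * (real (card ({1..j} - {m'})) / real j)"
      using that unfolding c c2 by (simp add: divide_simps)
    then have "(real (card ({1..j} - {m, m'})) / real j) ^ k
      \<le> ((real (card ({1..j} - {m})) / real j) * (real (card ({1..j} - {m'})) / real j)) ^ k"
      by (rule power_mono) simp
    then show ?thesis
      unfolding power_mult_distrib by (auto simp: hit_prob_def)
  qed
  then have "avoid_prob n k {m, m'} \<le> (\<Sum>j=1..n. (1 - hit_prob k m j) * (1 - hit_prob k m' j)) / real n"
    unfolding avoid_prob_eq by (intro divide_right_mono sum_mono) auto
  also have "\<dots> = (real n - A - B + C) / real n"
    by (simp add: A_B_C_def algebra_simps sum.distrib sum_subtractf)
  \<comment> \<open>Multiplying out gives the additional term \<open>(A / n) * (B / n)\<close>,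
    which is nonnegative.\<close>
  also have "\<dots> \<le> (1 - A / real n) * (1 - B / real n) + C / real n"
  proof -
    have "0 \<le> A / real n * (B / real n)"
      unfolding A_B_C_def by (intro mult_nonneg_nonneg divide_nonneg_nonneg sum_nonneg) (auto simp: hit_prob_bounds)
    then show ?thesis
      using assms(1) by (simp add: diff_divide_distrib add_divide_distrib algebra_simps)
  qed
  finally show ?thesis
    by (simp add: avoid_prob_single[OF assms(1)] A_B_C_def)
qed

lemma sum_of_bool_greater: "(\<Sum>j=1..n. of_bool (m < j) * c) = real (n - m) * c"
proof -
  have "(\<Sum>j=1..n. of_bool (m < j) * c) = (\<Sum>j\<in>{m<..n}. c)"
    by (intro sum.mono_neutral_cong_right) auto
  then show ?thesis by simp
qed

section \<open>Chebyshev's inequality and test functions\<close>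

lemma second_moment:
  fixes p Z :: "'a \<Rightarrow> real"
  assumes "finite \<Omega>" and p: "\<And>\<omega>. \<omega> \<in> \<Omega> \<Longrightarrow> 0 \<le> p \<omega>" "sum p \<Omega> = 1"
    and mean: "(\<Sum>\<omega>\<in>\<Omega>. p \<omega> * Z \<omega>) = \<mu>" "0 < \<mu>"
    and sq: "(\<Sum>\<omega>\<in>\<Omega>. p \<omega> * (Z \<omega>)\<^sup>2) \<le> \<mu> + e * \<mu>\<^sup>2"
  shows "5 - 4 * e - 4 / \<mu> \<le> (\<Sum>\<omega>\<in>\<Omega>. p \<omega> * of_bool (\<mu> / 2 \<le> Z \<omega>))"
proof -
  have ge: "1 - 4 / \<mu>\<^sup>2 * (Z \<omega> - \<mu>)\<^sup>2 \<le> of_bool (\<mu> / 2 \<le> Z \<omega>)" for \<omega>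
  proof (cases "\<mu> / 2 \<le> Z \<omega>")
    case False
    then have "(\<mu> / 2)\<^sup>2 \<le> (\<mu> - Z \<omega>)\<^sup>2"
      using mean(2) by (intro power_mono) auto
    then show ?thesis
      using False mean(2) by (simp add: field_simps power2_commute power_divide)
  qed simp
  \<comment> \<open>The variance is at most \<open>\<mu> + (e - 1) * \<mu>\<^sup>2\<close>, and
    Chebyshev's inequality at distance \<open>\<mu> / 2\<close> multiplies it by
    \<open>4 / \<mu>\<^sup>2\<close>. The result is close to 1 when \<open>e\<close> is close to 1
    and \<mu> is large.\<close>
  have "5 - 4 * e - 4 / \<mu> \<le> 1 - 4 / \<mu>\<^sup>2 * ((\<mu> + e * \<mu>\<^sup>2) - 2 * \<mu> * \<mu> + \<mu>\<^sup>2)"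
    using mean(2) by (simp add: field_simps power2_eq_square)
  also have "\<dots> \<le> 1 - 4 / \<mu>\<^sup>2 * ((\<Sum>\<omega>\<in>\<Omega>. p \<omega> * (Z \<omega>)\<^sup>2) - 2 * \<mu> * \<mu> + \<mu>\<^sup>2)"
    using sq by (intro diff_left_mono mult_left_mono) auto
  also have "\<dots> = (\<Sum>\<omega>\<in>\<Omega>. p \<omega>) - 4 / \<mu>\<^sup>2 *
      ((\<Sum>\<omega>\<in>\<Omega>. p \<omega> * (Z \<omega>)\<^sup>2) - 2 * \<mu> * (\<Sum>\<omega>\<in>\<Omega>. p \<omega> * Z \<omega>) + \<mu>\<^sup>2 * (\<Sum>\<omega>\<in>\<Omega>. p \<omega>))"
    by (simp add: p(2) mean(1))
  also have "\<dots> = (\<Sum>\<omega>\<in>\<Omega>. p \<omega> * (1 - 4 / \<mu>\<^sup>2 * (Z \<omega> - \<mu>)\<^sup>2))"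
  proof -
    have expand: "p \<omega> * (1 - a * (Z \<omega> - \<mu>)\<^sup>2)
      = p \<omega> - a * (p \<omega> * (Z \<omega>)\<^sup>2 - 2 * \<mu> * (p \<omega> * Z \<omega>) + \<mu>\<^sup>2 * p \<omega>)" for a \<omega>
      by (simp add: power2_diff algebra_simps)
    show ?thesis
      unfolding expand by (simp only: sum.distrib sum_subtractf flip: sum_distrib_left)
  qed
  also have "\<dots> \<le> (\<Sum>\<omega>\<in>\<Omega>. p \<omega> * of_bool (\<mu> / 2 \<le> Z \<omega>))"
    by (intro sum_mono mult_left_mono ge p)
  finally show ?thesis .
qed

text \<open>The difference of the two distributions has total mass 0, so \<open>f\<close> may be
  replaced by \<open>2 * f - 1\<close> at the price of a factor 2. As this function stays in
  \<open>[-1, 1]\<close>, the factor cancels the \<open>1 / 2\<close> of total variation.\<close>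

lemma shuffle_tv_ge_diff:
  assumes "1 \<le> n" and f: "\<And>x. \<bar>2 * f x - 1\<bar> \<le> 1"
  shows "(shuffle_op n k ^^ t) f id - (\<Sum>y\<in>Sym n. f y) / fact n \<le> shuffle_tv n k t"
proof -
  let ?M = "matrix_power_on (Sym n) (shuffle_matrix n k) t id"
  have M: "(\<Sum>y\<in>Sym n. ?M y * f y) = (shuffle_op n k ^^ t) f id"
    by (rule sum_matrix_power[OF permutes_id])
  have "(\<Sum>y\<in>Sym n. (?M y - 1 / fact n) * (2 * f y - 1))
    = 2 * ((\<Sum>y\<in>Sym n. ?M y * f y) - (\<Sum>y\<in>Sym n. f y) / fact n)
      - ((\<Sum>y\<in>Sym n. ?M y) - real (card (Sym n)) / fact n)"
    by (simp add: sum_distrib_left sum.distrib sum_subtractf sum_divide_distrib algebra_simps del: One_nat_def)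
  also have "\<dots> = 2 * ((shuffle_op n k ^^ t) f id - (\<Sum>y\<in>Sym n. f y) / fact n)"
    unfolding M sum_matrix_power_eq_1[OF assms(1)] card_Sym by simp
  finally have eq: "2 * ((shuffle_op n k ^^ t) f id - (\<Sum>y\<in>Sym n. f y) / fact n)
    = (\<Sum>y\<in>Sym n. (?M y - 1 / fact n) * (2 * f y - 1))" ..
  have "2 * ((shuffle_op n k ^^ t) f id - (\<Sum>y\<in>Sym n. f y) / fact n)
    \<le> (\<Sum>y\<in>Sym n. \<bar>?M y - 1 / fact n\<bar>)"
    unfolding eq
  proof (rule sum_mono)
    fix y
    have "(?M y - 1 / fact n) * (2 * f y - 1) \<le> \<bar>?M y - 1 / fact n\<bar> * \<bar>2 * f y - 1\<bar>"
      by (metis abs_ge_self abs_mult)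
    also have "\<dots> \<le> \<bar>?M y - 1 / fact n\<bar> * 1"
      by (intro mult_left_mono f) simp
    finally show "(?M y - 1 / fact n) * (2 * f y - 1) \<le> \<bar>?M y - 1 / fact n\<bar>" by simp
  qed
  moreover have "2 * a \<le> b \<Longrightarrow> a \<le> 1 / 2 * b" for a b :: real
    by linarith
  ultimately show ?thesis
    unfolding shuffle_tv_def card_Sym of_nat_fact by blast
qed

lemma card_permutes_fixing:
  assumes "m \<in> {1..n}"
  shows "card {\<sigma>\<in>Sym n. \<sigma> m = m} = fact (n - 1)"
proof -
  have "{\<sigma>\<in>Sym n. \<sigma> m = m} = {\<sigma>. \<sigma> permutes {1..n} - {m}}"
  proof (intro equalityI subsetI)
    fix \<sigma> assume "\<sigma> \<in> {\<sigma>\<in>Sym n. \<sigma> m = m}"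
    then show "\<sigma> \<in> {\<sigma>. \<sigma> permutes {1..n} - {m}}"
      by (auto intro: permutes_superset simp del: One_nat_def)
  next
    fix \<sigma> assume "\<sigma> \<in> {\<sigma>. \<sigma> permutes {1..n} - {m}}"
    then show "\<sigma> \<in> {\<sigma>\<in>Sym n. \<sigma> m = m}"
      by (auto intro: permutes_subset simp: permutes_not_in simp del: One_nat_def)
  qed
  then show ?thesis
    using assms by (simp add: card_permutations)
qed

text \<open>Markov's inequality: under the uniform measure a point is fixed with probability
  \<open>1 / n\<close>, so \<open>W\<close> contains at most one fixed point on average.\<close>

lemma sum_many_fixed_points_le:
  assumes "W \<subseteq> {1..n}" "0 < r"
  shows "(\<Sum>\<sigma>\<in>Sym n. of_bool (r \<le> (\<Sum>m\<in>W. of_bool (\<sigma> m = m)))) / fact n \<le> 1 / (r :: real)"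
proof (cases "n = 0")
  case True
  with assms show ?thesis by simp
next
  case False
  have W: "finite W" using assms(1) by (rule finite_subset) simp
  have "(\<Sum>\<sigma>\<in>Sym n. of_bool (r \<le> (\<Sum>m\<in>W. of_bool (\<sigma> m = m))))
    \<le> (\<Sum>\<sigma>\<in>Sym n. (\<Sum>m\<in>W. of_bool (\<sigma> m = m)) / r)"
    using assms(2) by (intro sum_mono) (auto simp: le_divide_eq sum_nonneg)
  also have "\<dots> = (\<Sum>m\<in>W. \<Sum>\<sigma>\<in>Sym n. of_bool (\<sigma> m = m)) / r"
    by (subst sum.swap) (simp add: sum_divide_distrib)
  also have "(\<Sum>m\<in>W. \<Sum>\<sigma>\<in>Sym n. of_bool (\<sigma> m = m) :: real) = (\<Sum>m\<in>W. fact (n - 1))"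
  proof (rule sum.cong[OF refl])
    fix m assume "m \<in> W"
    then have "(\<Sum>\<sigma>\<in>Sym n. of_bool (\<sigma> m = m)) = real (card {\<sigma>\<in>Sym n. \<sigma> m = m})"
      by (simp add: sum.If_cases of_bool_def finite_permutations Int_def)
    with \<open>m \<in> W\<close> assms(1) show "(\<Sum>\<sigma>\<in>Sym n. of_bool (\<sigma> m = m)) = (fact (n - 1) :: real)"
      by (subst (asm) card_permutes_fixing) auto
  qed
  also have "\<dots> / r \<le> fact n / r"
  proof -
    have "card W \<le> n" using card_mono[OF _ assms(1)] by simp
    then have "real (card W) * fact (n - 1) \<le> real n * fact (n - 1)"
      by (intro mult_right_mono) auto
    also have "\<dots> = fact n" using False by (simp add: fact_reduce)
    finally show ?thesis using assms(2) by (simp add: divide_right_mono)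
  qed
  finally show ?thesis
    using assms(2) by (simp add: field_simps)
qed

section \<open>The window of the last \<open>L\<close> positions\<close>

context
  fixes n k L :: nat and \<eta> :: real
  assumes n: "4 \<le> n" and k: "1 \<le> k" and \<eta>: "\<eta> \<le> 1" and L: "2 * real k * real L \<le> \<eta> * real n"
begin

text \<open>The hypotheses give \<open>2 * L \<le> n\<close>, so the window lies in the upper half,
  where \<open>k / j \<le> 2 * k / n\<close>.\<close>

lemma window_bounds:
  assumes "m \<in> {n - L<..n}"
  shows "real n / 2 \<le> real m" "real (n - m) \<le> real L" "1 \<le> m"
proof -
  have "real L \<le> real k * real L" using k by (simp add: mult_le_cancel_right1)
  moreover have "\<eta> * real n \<le> 1 * real n" using \<eta> by (intro mult_right_mono) auto
  ultimately have "2 * real L \<le> real n" using L by linarith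
  then have "2 * L \<le> n" by linarith
  then show "real n / 2 \<le> real m" "real (n - m) \<le> real L" "1 \<le> m" using assms n by auto
qed

lemma hit_prob_window_le:
  assumes "m \<in> {n - L<..n}" "1 \<le> j"
  shows "hit_prob k m j \<le> of_bool (j = m) + of_bool (m < j) * (2 * real k / real n)"
proof -
  have "of_bool (m < j) * (real k / real j) \<le> of_bool (m < j) * (2 * real k / real n)"
  proof (cases "m < j")
    case True
    with window_bounds[OF assms(1)] have "real n \<le> 2 * real j" by linarith
    then have "real k * real n \<le> real k * (2 * real j)" by (rule mult_left_mono) simp
    then show ?thesis using n True by (simp add: field_simps)
  qed simp
  with hit_prob_le[OF window_bounds(3)[OF assms(1)] assms(2), of k] show ?thesis by linarith
qed

text \<open>The value \<open>j = m\<close> adds 1 to the sum of hit probabilities, and at most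
  \<open>L\<close> larger values add at most \<open>2 * k / n\<close> each; the condition on
  \<open>L\<close> bounds their total by \<eta>.\<close>

lemma avoid_prob_window_ge:
  assumes m: "m \<in> {n - L<..n}"
  shows "1 - (1 + \<eta>) / real n \<le> avoid_prob n k {m}"
proof -
  have "(\<Sum>j=1..n. hit_prob k m j)
    \<le> (\<Sum>j=1..n. of_bool (j = m) + of_bool (m < j) * (2 * real k / real n))"
    by (intro sum_mono hit_prob_window_le[OF m]) auto
  also have "\<dots> = (\<Sum>j=1..n. of_bool (j = m)) + real (n - m) * (2 * real k / real n)"
    by (simp only: sum.distrib sum_of_bool_greater)
  also have "(\<Sum>j=1..n. of_bool (j = m)) = (1 :: real)"
    using m window_bounds[OF m] by (simp add: of_bool_def)
  also have "real (n - m) * (2 * real k / real n) \<le> real L * (2 * real k / real n)"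
    using window_bounds(2)[OF m] by (intro mult_right_mono) auto
  also have "\<dots> \<le> \<eta>"
    using L n by (simp add: field_simps)
  finally show ?thesis
    using n by (simp add: avoid_prob_single divide_right_mono)
qed

lemma avoid_prob_window_ge_half:
  assumes "m \<in> {n - L<..n}"
  shows "1 / 2 \<le> avoid_prob n k {m}"
proof -
  have "(1 + \<eta>) / real n \<le> 2 / 4" using n \<eta> by (intro frac_le) auto
  with avoid_prob_window_ge[OF assms] show ?thesis by linarith
qed

text \<open>Both positions can be touched only if \<open>j \<ge> m'\<close>. The value
  \<open>j = m'\<close> contributes at most \<open>2 * k / n\<close>, from the hit of
  \<open>m\<close>; the larger values together contribute at most the same, by the condition on
  \<open>L\<close> and \<open>\<eta> \<le> 1\<close>.\<close>

lemma sum_hit_prob_mult_le: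
  assumes m: "m \<in> {n - L<..n}" and m': "m' \<in> {n - L<..n}" and "m < m'"
  shows "(\<Sum>j=1..n. hit_prob k m j * hit_prob k m' j) \<le> 4 * real k / real n"
proof -
  let ?q = "2 * real k / real n"
  have "hit_prob k m j * hit_prob k m' j \<le> of_bool (j = m') * ?q + of_bool (m' < j) * (?q * ?q)" if "j \<in> {1..n}" for j
  proof -
    have le: "hit_prob k i j \<le> of_bool (j = i) + of_bool (i < j) * ?q" if "i \<in> {n - L<..n}" for i
      using hit_prob_window_le[OF that] \<open>j \<in> {1..n}\<close> by simp
    consider "j < m'" | "j = m'" | "m' < j" by linarith
    then show ?thesis
    proof cases
      case 1
      then have "hit_prob k m' j = 0"
        using le[OF m'] hit_prob_bounds(1)[of k m' j] by simp
      then show ?thesis by simp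
    next
      case 2
      have "hit_prob k m j * hit_prob k m' j \<le> hit_prob k m j * 1"
        by (intro mult_left_mono hit_prob_bounds)
      then show ?thesis
        using 2 le[OF m] \<open>m < m'\<close> by simp
    next
      case 3
      have "hit_prob k m j * hit_prob k m' j \<le> ?q * ?q"
        using 3 \<open>m < m'\<close> le[OF m] le[OF m']
        by (intro mult_mono hit_prob_bounds) auto
      then show ?thesis using 3 by simp
    qed
  qed
  then have "(\<Sum>j=1..n. hit_prob k m j * hit_prob k m' j)
    \<le> (\<Sum>j=1..n. of_bool (j = m') * ?q + of_bool (m' < j) * (?q * ?q))"
    by (intro sum_mono)
  also have "\<dots> = (\<Sum>j=1..n. of_bool (j = m') * ?q) + real (n - m') * (?q * ?q)"
    by (simp only: sum.distrib sum_of_bool_greater)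
  also have "(\<Sum>j=1..n. of_bool (j = m') * ?q) = ?q"
  proof -
    have "(\<Sum>j=1..n. of_bool (j = m') * ?q) = (\<Sum>j=1..n. if j = m' then ?q else 0)"
      by (intro sum.cong) auto
    then show ?thesis using m' window_bounds[OF m'] by simp
  qed
  also have "real (n - m') * (?q * ?q) \<le> 1 * ?q"
  proof -
    have "real (n - m') * ?q \<le> real L * ?q"
      using window_bounds(2)[OF m'] by (intro mult_right_mono) auto
    also have "\<dots> \<le> \<eta>" using L n by (simp add: field_simps)
    also note \<eta>
    finally have "real (n - m') * ?q * ?q \<le> 1 * ?q" by (intro mult_right_mono) auto
    then show ?thesis by (simp only: mult.assoc)
  qed
  finally show ?thesis by simp
qed

lemma avoid_prob_window_pair_le:
  assumes m: "m \<in> {n - L<..n}" and m': "m' \<in> {n - L<..n}" and "m \<noteq> m'"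
  shows "avoid_prob n k {m, m'}
    \<le> avoid_prob n k {m} * avoid_prob n k {m'} * (1 + 16 * real k / (real n)\<^sup>2)"
proof -
  have "(\<Sum>j=1..n. hit_prob k m j * hit_prob k m' j) \<le> 4 * real k / real n"
    using sum_hit_prob_mult_le[OF m m'] sum_hit_prob_mult_le[OF m' m] \<open>m \<noteq> m'\<close>
    by (cases m m' rule: linorder_cases) (simp_all add: mult.commute)
  then have "(\<Sum>j=1..n. hit_prob k m j * hit_prob k m' j) / real n \<le> (4 * real k / real n) / real n"
    by (intro divide_right_mono) auto
  \<comment> \<open>Both avoidance probabilities are at least \<open>1 / 2\<close>, so the additive
    error becomes a relative one at the cost of a factor 4.\<close>
  also have "\<dots> = 1 / 2 * (1 / 2) * (16 * real k / (real n)\<^sup>2)"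
    by (simp add: power2_eq_square)
  also have "\<dots> \<le> avoid_prob n k {m} * avoid_prob n k {m'} * (16 * real k / (real n)\<^sup>2)"
    using avoid_prob_window_ge_half[OF m] avoid_prob_window_ge_half[OF m']
    by (intro mult_right_mono mult_mono) auto
  finally show ?thesis
    using avoid_prob_pair_le[of n m m' k] n \<open>m \<noteq> m'\<close> by (simp add: algebra_simps)
qed

text \<open>A single bound for equal and distinct positions, shaped so that its double sum over the
  window is \<open>\<mu> + e * \<mu>\<^sup>2\<close>, as \<open>second_moment\<close> requires. For
  distinct positions, \<open>1 + x \<le> exp x\<close> is raised to the power
  \<open>t\<close>.\<close>

lemma avoid_prob_window_pair_power_le:
  assumes m: "m \<in> {n - L<..n}" and m': "m' \<in> {n - L<..n}"
  shows "avoid_prob n k {m, m'} ^ t \<le> of_bool (m = m') * avoid_prob n k {m} ^ t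
    + avoid_prob n k {m} ^ t * avoid_prob n k {m'} ^ t * exp (16 * real k * real t / (real n)\<^sup>2)"
proof (cases "m = m'")
  case True
  then show ?thesis
    using avoid_prob_window_ge_half[OF m'] by simp
next
  case False
  have pos: "0 \<le> avoid_prob n k S" for S
    unfolding avoid_prob_def by (intro sum_nonneg mult_nonneg_nonneg) (auto simp: index_weight_nonneg)
  let ?x = "16 * real k / (real n)\<^sup>2"
  have "avoid_prob n k {m, m'} ^ t \<le> (avoid_prob n k {m} * avoid_prob n k {m'} * (1 + ?x)) ^ t"
    by (intro power_mono avoid_prob_window_pair_le[OF m m' False] pos)
  also have "\<dots> \<le> (avoid_prob n k {m} * avoid_prob n k {m'} * exp ?x) ^ t"
    using pos by (intro power_mono mult_left_mono) auto
  also have "\<dots> = avoid_prob n k {m} ^ t * avoid_prob n k {m'} ^ t * exp ?x ^ t"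
    by (simp only: power_mult_distrib)
  also have "exp ?x ^ t = exp (16 * real k * real t / (real n)\<^sup>2)"
    by (simp add: mult_ac flip: exp_of_nat_mult)
  finally show ?thesis using False by simp
qed

text \<open>The second moment method for the number \<open>Z\<close> of untouched window positions,
  set against Markov's inequality for fixed points under the uniform measure. The costs
  \<open>4 / \<mu>\<close> and \<open>2 / \<mu>\<close> add up to \<open>6 / \<mu>\<close>.\<close>

lemma shuffle_tv_ge:
  assumes "1 \<le> L" "0 \<le> \<eta>"
  shows "5 - 4 * exp (16 * real k * real t / (real n)\<^sup>2)
      - 6 / (real L * (1 - (1 + \<eta>) / real n) ^ t) \<le> shuffle_tv n k t"
proof -
  define W where "W = {n - L<..n}"
  define \<Omega> where "\<Omega> = lists_of (shuffle_index n k) t"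
  define Z where "Z = (\<lambda>as. \<Sum>m\<in>W. of_bool (\<forall>a\<in>set as. avoids {m} a) :: real)"
  define \<mu> where "\<mu> = (\<Sum>m\<in>W. avoid_prob n k {m} ^ t)"
  define f where "f = (\<lambda>\<sigma>. of_bool (\<mu> / 2 \<le> (\<Sum>m\<in>W. of_bool (\<sigma> m = m))) :: real)"
  let ?e = "exp (16 * real k * real t / (real n)\<^sup>2)"
  let ?\<mu>0 = "real L * (1 - (1 + \<eta>) / real n) ^ t"
  have "real L \<le> real k * real L" using k by (simp add: mult_le_cancel_right1)
  moreover have "\<eta> * real n \<le> 1 * real n" using \<eta> by (intro mult_right_mono) auto
  ultimately have "L \<le> n" using L by linarith
  have W: "finite W" "card W = L" "W \<subseteq> {1..n}"
    using \<open>L \<le> n\<close> by (auto simp: W_def)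
  have \<Omega>: "finite \<Omega>" by (simp add: \<Omega>_def finite_shuffle_index)
  have "(1 + \<eta>) / real n \<le> 2 / 4" using n \<eta> by (intro frac_le) auto
  then have pos: "0 < 1 - (1 + \<eta>) / real n" by linarith
  then have \<mu>0: "0 < ?\<mu>0" using assms(1) by simp
  have "(\<Sum>m\<in>W. (1 - (1 + \<eta>) / real n) ^ t) \<le> \<mu>"
    unfolding \<mu>_def using pos avoid_prob_window_ge
    by (intro sum_mono power_mono) (auto simp: W_def)
  then have \<mu>: "?\<mu>0 \<le> \<mu>" by (simp add: W)
  have mean: "(\<Sum>as\<in>\<Omega>. path_weight n k as * Z as) = \<mu>"
    unfolding Z_def \<mu>_def \<Omega>_def sum_path_weight_avoids[symmetric] sum_distrib_left
    by (rule sum.swap)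
  have "(\<Sum>as\<in>\<Omega>. path_weight n k as * (Z as)\<^sup>2)
    = (\<Sum>as\<in>\<Omega>. \<Sum>m\<in>W. \<Sum>m'\<in>W. path_weight n k as * of_bool (\<forall>a\<in>set as. avoids {m, m'} a))"
  proof (rule sum.cong[OF refl])
    fix "as"
    have avoids2: "(\<forall>a\<in>set as. avoids {m, m'} a)
      \<longleftrightarrow> (\<forall>a\<in>set as. avoids {m} a) \<and> (\<forall>a\<in>set as. avoids {m'} a)" for m m'
      by (auto simp: avoids_def)
    show "path_weight n k as * (Z as)\<^sup>2
      = (\<Sum>m\<in>W. \<Sum>m'\<in>W. path_weight n k as * of_bool (\<forall>a\<in>set as. avoids {m, m'} a))"
      by (simp only: Z_def power2_eq_square sum_product) (simp only: sum_distrib_left avoids2 of_bool_conj)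
  qed
  also have "\<dots> = (\<Sum>m\<in>W. \<Sum>m'\<in>W. avoid_prob n k {m, m'} ^ t)"
    unfolding \<Omega>_def sum_path_weight_avoids[symmetric]
    by (subst sum.swap, intro sum.cong refl, rule sum.swap)
  also have "\<dots> \<le> (\<Sum>m\<in>W. \<Sum>m'\<in>W. of_bool (m = m') * avoid_prob n k {m} ^ t
      + avoid_prob n k {m} ^ t * avoid_prob n k {m'} ^ t * ?e)"
    by (intro sum_mono avoid_prob_window_pair_power_le) (auto simp: W_def)
  also have "\<dots> = (\<Sum>m\<in>W. \<Sum>m'\<in>W. of_bool (m = m') * avoid_prob n k {m} ^ t) + ?e * \<mu>\<^sup>2"
    by (simp add: sum.distrib \<mu>_def power2_eq_square sum_product sum_distrib_left mult_ac)
  also have "(\<Sum>m\<in>W. \<Sum>m'\<in>W. of_bool (m = m') * avoid_prob n k {m} ^ t) = \<mu>"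
    unfolding \<mu>_def
  proof (rule sum.cong[OF refl])
    fix m assume "m \<in> W"
    have "(\<Sum>m'\<in>W. of_bool (m = m') * avoid_prob n k {m} ^ t)
      = (\<Sum>m'\<in>W. if m = m' then avoid_prob n k {m} ^ t else 0)"
      by (intro sum.cong) auto
    then show "(\<Sum>m'\<in>W. of_bool (m = m') * avoid_prob n k {m} ^ t) = avoid_prob n k {m} ^ t"
      using W \<open>m \<in> W\<close> by simp
  qed
  finally have sq: "(\<Sum>as\<in>\<Omega>. path_weight n k as * (Z as)\<^sup>2) \<le> \<mu> + ?e * \<mu>\<^sup>2" .
  have "5 - 4 * ?e - 4 / \<mu> \<le> (\<Sum>as\<in>\<Omega>. path_weight n k as * of_bool (\<mu> / 2 \<le> Z as))"
    using n \<mu> \<mu>0 by (intro second_moment \<Omega> path_weight_nonneg mean sq) (auto simp: \<Omega>_def sum_path_weight)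
  also have "\<dots> \<le> (\<Sum>as\<in>\<Omega>. path_weight n k as * f (id \<circ> path_perm as))"
  proof (intro sum_mono mult_left_mono path_weight_nonneg)
    fix "as"
    \<comment> \<open>An untouched position is a fixed point, so the path has at least
      \<open>Z as\<close> fixed points in the window.\<close>
    have "Z as \<le> (\<Sum>m\<in>W. of_bool (path_perm as m = m))"
      unfolding Z_def by (intro sum_mono) (auto simp: path_perm_fixes)
    then show "of_bool (\<mu> / 2 \<le> Z as) \<le> f (id \<circ> path_perm as)"
      by (auto simp: f_def)
  qed
  also have "\<dots> = (shuffle_op n k ^^ t) f id"
    unfolding \<Omega>_def by (rule shuffle_op_funpow_eq[symmetric])
  finally have prob: "5 - 4 * ?e - 4 / \<mu> \<le> (shuffle_op n k ^^ t) f id" .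
  have "6 / \<mu> \<le> 6 / ?\<mu>0"
    using \<mu> \<mu>0 by (intro divide_left_mono) auto
  then have "5 - 4 * ?e - 6 / ?\<mu>0 \<le> 5 - 4 * ?e - 6 / \<mu>"
    by (rule diff_left_mono)
  also have "\<dots> = (5 - 4 * ?e - 4 / \<mu>) - 1 / (\<mu> / 2)"
    by simp
  also have "\<dots> \<le> (shuffle_op n k ^^ t) f id - (\<Sum>y\<in>Sym n. f y) / fact n"
  proof (rule diff_mono[OF prob])
    show "(\<Sum>y\<in>Sym n. f y) / fact n \<le> 1 / (\<mu> / 2)"
      unfolding f_def using \<mu> \<mu>0 by (intro sum_many_fixed_points_le W) auto
  qed
  also have "\<dots> \<le> shuffle_tv n k t"
    using n by (intro shuffle_tv_ge_diff) (auto simp: f_def)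
  finally show ?thesis .
qed

end

section \<open>Cutoff\<close>

text \<open>A diagonal argument: bounds for each fixed \<eta> yield one null sequence \<rho> such
  that eventually they hold with \<open>\<eta> = \<rho> n\<close>. A window that is small against
  \<open>t\<close> but large against \<open>\<rho> * t\<close> then gives both limits.\<close>

lemma exhibits_cutoffI:
  fixes d :: "nat \<Rightarrow> nat \<Rightarrow> real" and t :: "nat \<Rightarrow> real"
  assumes upper: "\<And>\<eta>. 0 < \<eta> \<Longrightarrow> \<forall>\<^sub>F n in sequentially. \<forall>s. (1 + \<eta>) * t n \<le> real s \<longrightarrow> d n s \<le> \<eta>"
    and lower: "\<And>\<eta>. 0 < \<eta> \<Longrightarrow> \<forall>\<^sub>F n in sequentially. \<forall>s. real s \<le> (1 - \<eta>) * t n \<longrightarrow> 1 - \<eta> \<le> d n s"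
    and d: "\<forall>\<^sub>F n in sequentially. \<forall>s. 0 \<le> d n s \<and> d n s \<le> 1"
    and t: "filterlim t at_top sequentially"
  shows "exhibits_cutoff d t"
proof -
  define Q where "Q = (\<lambda>\<eta> n. \<forall>s. ((1 + \<eta>) * t n \<le> real s \<longrightarrow> d n s \<le> \<eta>) \<and>
    (real s \<le> (1 - \<eta>) * t n \<longrightarrow> 1 - \<eta> \<le> d n s))"
  have Q: "\<forall>\<^sub>F n in sequentially. Q \<eta> n" if "0 < \<eta>" for \<eta>
    using upper[OF that] lower[OF that] by eventually_elim (auto simp: Q_def)
  \<comment> \<open>Enlarging \<eta> weakens both bounds and, as \<open>t n \<ge> 0\<close>, moves
    both time ranges away from \<open>t n\<close>.\<close>
  have Q_mono: "Q \<eta>' n" if "Q \<eta> n" "\<eta> \<le> \<eta>'" "0 \<le> t n" for \<eta> \<eta>' n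
    unfolding Q_def
  proof (intro allI conjI impI)
    fix s
    have *: "\<eta> * t n \<le> \<eta>' * t n" using that by (intro mult_right_mono)
    show "d n s \<le> \<eta>'" if "(1 + \<eta>') * t n \<le> real s"
      using \<open>Q \<eta> n\<close> \<open>\<eta> \<le> \<eta>'\<close> * that unfolding Q_def by (smt (verit) distrib_right)
    show "1 - \<eta>' \<le> d n s" if "real s \<le> (1 - \<eta>') * t n"
      using \<open>Q \<eta> n\<close> \<open>\<eta> \<le> \<eta>'\<close> * that unfolding Q_def by (smt (verit) left_diff_distrib)
  qed
  have t_ge: "\<forall>\<^sub>F n in sequentially. c \<le> t n" for c
    using t by (simp add: filterlim_at_top)
  \<comment> \<open>The summand \<open>1 / (\<bar>t n\<bar> + 1)\<close> makes the infimum strict and absorbs the rounding error.\<close>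
  define S where "S = (\<lambda>n. {\<eta>. 0 < \<eta> \<and> (Q \<eta> n \<or> 1 \<le> \<eta>)})"
  define \<rho> where "\<rho> = (\<lambda>n. Inf (S n) + 1 / (\<bar>t n\<bar> + 1))"
  have S_ne: "S n \<noteq> {}" for n
    unfolding S_def by (rule ex_in_conv[THEN iffD1], rule exI[of _ 1]) simp
  have S_bdd: "bdd_below (S n)" for n
    unfolding S_def by (rule bdd_belowI[of _ 0]) auto
  have Inf_nonneg: "0 \<le> Inf (S n)" for n
    using S_ne by (rule cInf_greatest) (auto simp: S_def)
  have \<rho>_ge: "1 / (\<bar>t n\<bar> + 1) \<le> \<rho> n" for n
    using Inf_nonneg[of n] by (simp add: \<rho>_def)
  have \<rho>_pos: "0 < \<rho> n" for n
    using \<rho>_ge[of n] by (smt (verit) divide_pos_pos)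
  have \<rho>_Q: "\<forall>\<^sub>F n in sequentially. Q (\<rho> n) n"
    using Q[of 1, OF zero_less_one] t_ge[of 0]
  proof eventually_elim
    case (elim n)
    have "Inf (S n) < \<rho> n" by (simp add: \<rho>_def)
    then obtain \<eta> where "\<eta> \<in> S n" "\<eta> < \<rho> n"
      using cInf_lessD[OF S_ne] by blast
    from \<open>\<eta> \<in> S n\<close> have "Q \<eta> n \<or> 1 \<le> \<eta>" by (simp add: S_def)
    \<comment> \<open>A member of \<open>S n\<close> that is at least 1 also satisfies
      \<open>Q\<close>, by monotonicity from \<open>Q 1 n\<close>.\<close>
    then have "Q \<eta> n"
      using Q_mono[OF elim(1) _ elim(2)] by blast
    then show ?case
      using \<open>\<eta> < \<rho> n\<close> elim(2) by (rule Q_mono[OF _ less_imp_le])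
  qed
  have Inf_lim: "(\<lambda>n. Inf (S n)) \<longlonglongrightarrow> 0"
  proof (rule tendstoI)
    fix e :: real assume "0 < e"
    then have "\<forall>\<^sub>F n in sequentially. Q (e / 2) n" by (intro Q) simp
    then show "\<forall>\<^sub>F n in sequentially. dist (Inf (S n)) 0 < e"
    proof eventually_elim
      case (elim n)
      then have "Inf (S n) \<le> e / 2"
        using \<open>0 < e\<close> by (intro cInf_lower S_bdd) (simp add: S_def)
      then show ?case using Inf_nonneg[of n] \<open>0 < e\<close> by simp
    qed
  qed
  have "filterlim (\<lambda>n. \<bar>t n\<bar> + 1) at_top sequentially"
    by (rule filterlim_at_top_mono[OF t]) (auto intro!: always_eventually)
  then have "(\<lambda>n. 1 / (\<bar>t n\<bar> + 1)) \<longlonglongrightarrow> 0"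
    by (intro tendsto_divide_0[OF tendsto_const] filterlim_at_top_imp_at_infinity)
  from tendsto_add[OF Inf_lim this] have \<rho>_lim: "\<rho> \<longlonglongrightarrow> 0"
    by (simp add: \<rho>_def)
  have \<rho>_t: "\<forall>\<^sub>F n in sequentially. 1 / 2 \<le> \<rho> n * t n"
    using t_ge[of 1]
  proof eventually_elim
    case (elim n)
    have "1 / 2 \<le> 1 / (\<bar>t n\<bar> + 1) * t n" using elim by (simp add: field_simps)
    also have "\<dots> \<le> \<rho> n * t n" using elim by (intro mult_right_mono \<rho>_ge) auto
    finally show ?case .
  qed
  \<comment> \<open>As \<open>\<rho>\<close> is \<open>o(sqrt \<rho>)\<close>, this window gives the limits 0 and 1 for every single \<open>c > 0\<close>.\<close>
  define w where "w = (\<lambda>n. if 0 < t n then sqrt (\<rho> n) * t n else 1)"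
  have w_pos: "0 < w n" for n
    using \<rho>_pos[of n] by (simp add: w_def)
  have sqrt_lim: "(\<lambda>n. sqrt (\<rho> n)) \<longlonglongrightarrow> 0"
    using tendsto_real_sqrt[OF \<rho>_lim] by simp
  have w_o: "w \<in> o(t)"
  proof (rule smalloI_tendsto)
    show "\<forall>\<^sub>F n in sequentially. t n \<noteq> 0"
      using t_ge[of 1] by eventually_elim auto
    have "\<forall>\<^sub>F n in sequentially. sqrt (\<rho> n) = w n / t n"
      using t_ge[of 1] by eventually_elim (auto simp: w_def)
    then show "(\<lambda>n. w n / t n) \<longlonglongrightarrow> 0"
      by (rule Lim_transform_eventually[OF sqrt_lim])
  qed
  \<comment> \<open>Two copies of \<open>\<rho> n * t n\<close>: one is the distance from
    \<open>t n\<close> that \<open>Q\<close> demands, the other is at least \<open>1 / 2\<close> and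
    pays for the rounding.\<close>
  have cw: "\<forall>\<^sub>F n in sequentially. 2 * (\<rho> n * t n) \<le> c * w n" if "0 < c" for c
  proof -
    have "\<forall>\<^sub>F n in sequentially. sqrt (\<rho> n) < c / 2"
      using sqrt_lim that by (intro order_tendstoD) auto
    then show ?thesis
      using t_ge[of 1]
    proof eventually_elim
      case (elim n)
      have "2 * (\<rho> n * t n) = (2 * sqrt (\<rho> n)) * (sqrt (\<rho> n) * t n)"
        using \<rho>_pos[of n] by simp
      also have "\<dots> \<le> c * (sqrt (\<rho> n) * t n)"
        using elim \<rho>_pos[of n] by (intro mult_right_mono) auto
      finally show ?case using elim by (simp add: w_def)
    qed
  qed
  have lim1: "(\<lambda>n. d n (nat (round (t n - c * w n)))) \<longlonglongrightarrow> 1" if "0 < c" for c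
  proof (rule tendsto_sandwich)
    have "\<forall>\<^sub>F n in sequentially. \<rho> n < 1"
      using \<rho>_lim by (intro order_tendstoD) auto
    then show "\<forall>\<^sub>F n in sequentially. 1 - \<rho> n \<le> d n (nat (round (t n - c * w n)))"
      using \<rho>_Q \<rho>_t cw[OF that] t_ge[of 1]
    proof eventually_elim
      case (elim n)
      \<comment> \<open>This sign covers the case in which \<open>nat\<close> truncates a negative
        time to 0.\<close>
      have "0 \<le> (1 - \<rho> n) * t n" using elim by simp
      moreover have "of_int (round (t n - c * w n)) \<le> (1 - \<rho> n) * t n"
        using of_int_round_le[of "t n - c * w n"] elim by (simp add: algebra_simps)
      ultimately have "real (nat (round (t n - c * w n))) \<le> (1 - \<rho> n) * t n" by simp
      then show ?case using elim(2) by (simp add: Q_def)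
    qed
    show "\<forall>\<^sub>F n in sequentially. d n (nat (round (t n - c * w n))) \<le> 1"
      using d by eventually_elim auto
    show "(\<lambda>n. 1 - \<rho> n) \<longlonglongrightarrow> 1"
      using tendsto_diff[OF tendsto_const \<rho>_lim, of 1] by simp
  qed simp
  have lim0: "(\<lambda>n. d n (nat (round (t n + c * w n)))) \<longlonglongrightarrow> 0" if "0 < c" for c
  proof (rule tendsto_sandwich)
    show "\<forall>\<^sub>F n in sequentially. d n (nat (round (t n + c * w n))) \<le> \<rho> n"
      using \<rho>_Q \<rho>_t cw[OF that]
    proof eventually_elim
      case (elim n)
      have "(1 + \<rho> n) * t n \<le> of_int (round (t n + c * w n))"
        using of_int_round_ge[of "t n + c * w n"] elim by (simp add: algebra_simps)
      also have "\<dots> \<le> real (nat (round (t n + c * w n)))" by linarith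
      finally show ?case using elim(1) by (simp add: Q_def)
    qed
    show "\<forall>\<^sub>F n in sequentially. 0 \<le> d n (nat (round (t n + c * w n)))"
      using d by eventually_elim auto
  qed (simp_all add: \<rho>_lim)
  show ?thesis
    unfolding exhibits_cutoff_def
  proof (intro exI[of _ w] conjI allI w_pos w_o)
    show "has_iterated_limit (\<lambda>c n. d n (nat (round (t n - c * w n)))) 1"
      unfolding has_iterated_limit_def using lim1
      by (intro exI[of _ "\<lambda>_. 1"]) (auto intro!: eventually_mono[OF eventually_gt_at_top[of 0]])
    show "has_iterated_limit (\<lambda>c n. d n (nat (round (t n + c * w n)))) 0"
      unfolding has_iterated_limit_def using lim0
      by (intro exI[of _ "\<lambda>_. 0"]) (auto intro!: eventually_mono[OF eventually_gt_at_top[of 0]])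
  qed
qed

section \<open>Asymptotic form of both bounds\<close>

lemma shuffle_tv_nonneg: "0 \<le> shuffle_tv n k t"
  unfolding shuffle_tv_def by (simp add: sum_nonneg)

lemma matrix_power_nonneg: "0 \<le> matrix_power_on S (shuffle_matrix n k) t x y"
  by (induction t arbitrary: y) (auto simp: shuffle_matrix_def shuffle_dist_nonneg intro!: sum_nonneg)

lemma shuffle_tv_le_1:
  assumes "1 \<le> n"
  shows "shuffle_tv n k t \<le> 1"
proof -
  let ?M = "matrix_power_on (Sym n) (shuffle_matrix n k) t id"
  have "(\<Sum>y\<in>Sym n. \<bar>?M y - 1 / fact n\<bar>) \<le> (\<Sum>y\<in>Sym n. ?M y + 1 / fact n)"
  proof (rule sum_mono)
    fix y
    have "0 \<le> ?M y" by (rule matrix_power_nonneg)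
    moreover have "0 \<le> 1 / (fact n :: real)" by simp
    ultimately show "\<bar>?M y - 1 / fact n\<bar> \<le> ?M y + 1 / fact n" by linarith
  qed
  also have "\<dots> = 2"
    using sum_matrix_power_eq_1[OF assms, of k t] card_Sym[of n]
    by (simp add: sum.distrib del: One_nat_def)
  finally show ?thesis
    unfolding shuffle_tv_def card_Sym by simp
qed

text \<open>The coupon collector bound combined with \<open>1 - 1 / n \<le> exp (- 1 / n)\<close>;
  from the given time on it is at most \<open>n * n powr (- (1 + \<eta>))\<close>.\<close>

lemma shuffle_tv_le_powr:
  assumes "2 \<le> n" "1 \<le> k" "(1 + \<eta>) * (real n * ln (real n)) \<le> real t"
  shows "shuffle_tv n k t \<le> real n powr (- \<eta>)"
proof -
  have "shuffle_tv n k t \<le> real n * (1 - 1 / real n) ^ t"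
    using assms by (intro shuffle_tv_le) auto
  also have "\<dots> \<le> real n * exp (- 1 / real n) ^ t"
    using assms(1) exp_ge_add_one_self[of "- 1 / real n"] by (intro mult_left_mono power_mono) auto
  also have "exp (- 1 / real n) ^ t = exp (- (real t / real n))"
    by (simp flip: exp_of_nat_mult)
  also have "\<dots> \<le> exp (- ((1 + \<eta>) * ln (real n)))"
    using assms(1,3) by (simp add: field_simps)
  also have "real n * exp (- ((1 + \<eta>) * ln (real n))) = real n powr (1 + - (1 + \<eta>))"
    using assms(1) by (simp only: powr_add) (simp add: powr_def algebra_simps)
  finally show ?thesis using assms(1) by simp
qed

text \<open>The mean number of untouched positions is at least of order
  \<open>L * n powr (- (1 - \<eta>\<^sup>2))\<close>, with \<open>L\<close> about
  \<open>\<eta> * n / (2 * k)\<close>. Half of the exponent \<open>\<eta>\<^sup>2\<close> pays for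
  \<open>k\<close>, and the other half makes the mean large.\<close>

lemma shuffle_tv_ge_asymp:
  assumes n: "4 \<le> n" and k: "1 \<le> k" "real k \<le> real n powr (\<eta>\<^sup>2 / 2)" and \<eta>: "0 < \<eta>" "\<eta> < 1"
    and large: "2 * sqrt (real n) \<le> \<eta> * real n"
    and t: "real t \<le> (1 - \<eta>) * (real n * ln (real n))"
  shows "5 - 4 * exp (16 * sqrt (real n) * ln (real n) / real n)
      - 6 / (\<eta> / 4 * real n powr (\<eta>\<^sup>2 / 2) * exp (- 8 * ln (real n) / real n)) \<le> shuffle_tv n k t"
proof -
  define y where "y = \<eta> * real n / (2 * real k)"
  \<comment> \<open>The largest window allowed by \<open>2 * k * L \<le> \<eta> * n\<close>; since
    \<open>y \<ge> 1\<close>, rounding down loses at most a factor 2.\<close>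
  define L where "L = nat \<lfloor>y\<rfloor>"
  define x where "x = (1 + \<eta>) / real n"
  have ln: "0 < ln (real n)" using n by simp
  have "\<eta>\<^sup>2 \<le> 1" using \<eta> by (simp add: power_le_one)
  then have "real n powr (\<eta>\<^sup>2 / 2) \<le> real n powr (1 / 2)"
    using n by (intro powr_mono) auto
  \<comment> \<open>This crude bound on \<open>k\<close> already makes the correlation exponent
    \<open>16 * k * t / n\<^sup>2\<close> vanish in the limit.\<close>
  with k(2) have k_sqrt: "real k \<le> sqrt (real n)" by (simp add: powr_half_sqrt)
  have "2 * real k \<le> \<eta> * real n" using k_sqrt large by linarith
  then have y: "1 \<le> y" using k(1) by (simp add: y_def field_simps)
  then have L: "1 \<le> L" "real L \<le> y" "y / 2 \<le> real L"
  proof -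
    have "1 \<le> \<lfloor>y\<rfloor>" using y by (simp add: le_floor_iff)
    then have "real L = of_int \<lfloor>y\<rfloor>" "1 \<le> L" by (simp_all add: L_def nat_le_eq_zle le_nat_iff)
    then show "1 \<le> L" "real L \<le> y" "y / 2 \<le> real L"
      using \<open>1 \<le> \<lfloor>y\<rfloor>\<close> by linarith+
  qed
  have tv: "5 - 4 * exp (16 * real k * real t / (real n)\<^sup>2) - 6 / (real L * (1 - x) ^ t) \<le> shuffle_tv n k t"
    unfolding x_def using n k \<eta> L
    by (intro shuffle_tv_ge) (auto simp: y_def field_simps)
  have "16 * real k * real t / (real n)\<^sup>2
    \<le> 16 * sqrt (real n) * ((1 - \<eta>) * (real n * ln (real n))) / (real n)\<^sup>2"
    using k_sqrt t by (intro divide_right_mono mult_mono) auto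
  also have "\<dots> \<le> 16 * sqrt (real n) * (1 * (real n * ln (real n))) / (real n)\<^sup>2"
    using \<eta> ln by (intro divide_right_mono mult_left_mono mult_right_mono) auto
  also have "\<dots> = 16 * sqrt (real n) * ln (real n) / real n"
    using n by (simp add: power2_eq_square)
  finally have e: "exp (16 * real k * real t / (real n)\<^sup>2) \<le> exp (16 * sqrt (real n) * ln (real n) / real n)"
    by simp
  have x: "0 \<le> x" "x \<le> 1 / 2"
  proof -
    have "x \<le> 2 / 4" unfolding x_def using n \<eta> by (intro frac_le) auto
    then show "x \<le> 1 / 2" by simp
  qed (use \<eta> in \<open>simp add: x_def\<close>)
  have "real t * (x + 2 * x\<^sup>2) \<le> (1 - \<eta>) * (real n * ln (real n)) * (x + 2 * x\<^sup>2)"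
    using t x by (intro mult_right_mono) auto
  \<comment> \<open>The leading term comes from \<open>(1 - \<eta>) * (1 + \<eta>)\<close>; the
    quadratic term is only of order \<open>ln n / n\<close>.\<close>
  also have "\<dots> = (1 - \<eta>\<^sup>2) * ln (real n) + 2 * ((1 - \<eta>) * (1 + \<eta>)\<^sup>2) * (ln (real n) / real n)"
    using n by (simp add: x_def field_simps power2_eq_square)
  also have "\<dots> \<le> (1 - \<eta>\<^sup>2) * ln (real n) + 8 * (ln (real n) / real n)"
  proof -
    have "(1 - \<eta>) * (1 + \<eta>)\<^sup>2 \<le> 1 * 2\<^sup>2"
      using \<eta> by (intro mult_mono power_mono) auto
    then show ?thesis using ln n by (intro add_left_mono mult_right_mono) auto
  qed
  finally have "real t * (x + 2 * x\<^sup>2) \<le> (1 - \<eta>\<^sup>2) * ln (real n) + 8 * (ln (real n) / real n)" .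
  moreover have "- x - 2 * x\<^sup>2 \<le> ln (1 - x)"
    using x by (rule ln_one_minus_pos_lower_bound)
  then have "real t * (- x - 2 * x\<^sup>2) \<le> real t * ln (1 - x)"
    by (rule mult_left_mono) simp
  ultimately have "- ((1 - \<eta>\<^sup>2) * ln (real n)) - 8 * ln (real n) / real n \<le> real t * ln (1 - x)"
    by (simp add: algebra_simps)
  then have "exp (- ((1 - \<eta>\<^sup>2) * ln (real n)) - 8 * ln (real n) / real n) \<le> exp (real t * ln (1 - x))"
    by simp
  also have "\<dots> = (1 - x) ^ t"
    using x by (simp add: exp_of_nat_mult)
  finally have "exp (- ((1 - \<eta>\<^sup>2) * ln (real n)) - 8 * ln (real n) / real n) \<le> (1 - x) ^ t" .
  \<comment> \<open>The 4 is the 2 in \<open>y\<close> times the 2 lost by rounding down.\<close>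
  moreover have "\<eta> * real n / (4 * real n powr (\<eta>\<^sup>2 / 2)) \<le> \<eta> * real n / (4 * real k)"
    using k \<eta> n by (intro divide_left_mono mult_left_mono) auto
  then have "\<eta> * real n / (4 * real n powr (\<eta>\<^sup>2 / 2)) \<le> real L"
    using L(3) by (simp add: y_def)
  ultimately have "\<eta> * real n / (4 * real n powr (\<eta>\<^sup>2 / 2)) *
      exp (- ((1 - \<eta>\<^sup>2) * ln (real n)) - 8 * ln (real n) / real n) \<le> real L * (1 - x) ^ t"
    by (intro mult_mono) auto
  moreover have "\<eta> * real n / (4 * real n powr (\<eta>\<^sup>2 / 2)) *
      exp (- ((1 - \<eta>\<^sup>2) * ln (real n)) - 8 * ln (real n) / real n)
    = \<eta> / 4 * real n powr (\<eta>\<^sup>2 / 2) * exp (- 8 * ln (real n) / real n)"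
  proof -
    have "exp (- ((1 - \<eta>\<^sup>2) * ln (real n)) - 8 * ln (real n) / real n)
      = real n powr (\<eta>\<^sup>2 - 1) * exp (- 8 * ln (real n) / real n)"
      using n by (simp add: powr_def algebra_simps flip: exp_add)
    moreover have "real n / real n powr (\<eta>\<^sup>2 / 2) * real n powr (\<eta>\<^sup>2 - 1)
      = real n powr (1 - \<eta>\<^sup>2 / 2 + (\<eta>\<^sup>2 - 1))"
      using n by (simp only: powr_add powr_diff) simp
    moreover have "1 - \<eta>\<^sup>2 / 2 + (\<eta>\<^sup>2 - 1) = \<eta>\<^sup>2 / 2"
      by simp
    moreover have "\<eta> * N / (4 * P) * (R * E) = \<eta> / 4 * (N / P * R) * E" for N P R E :: real
      by simp
    ultimately show ?thesis
      by (simp only:)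
  qed
  ultimately have le: "\<eta> / 4 * real n powr (\<eta>\<^sup>2 / 2) * exp (- 8 * ln (real n) / real n)
    \<le> real L * (1 - x) ^ t" (is "?M \<le> ?R")
    by (simp only:)
  have "0 < ?M" using \<eta> n by simp
  then have "0 < ?R" using le by (rule order.strict_trans2)
  with \<open>0 < ?M\<close> have "6 / ?R \<le> 6 / ?M"
    using le by (intro frac_le) simp_all
  with tv e show ?thesis by linarith
qed

theorem mainTheorem5:
  fixes k :: "nat \<Rightarrow> nat"
  assumes "\<And>n. 1 \<le> n \<Longrightarrow> 1 \<le> k n"
    and "\<exists>\<epsilon> :: nat \<Rightarrow> real. \<epsilon> \<in> o(\<lambda>_. 1) \<and> (\<forall>\<^sub>F n in sequentially. real (k n) = real n powr \<epsilon> n)"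
  shows "exhibits_cutoff (\<lambda>n. shuffle_tv n (k n)) (\<lambda>n. real n * ln (real n))"
proof (rule exhibits_cutoffI)
  show "filterlim (\<lambda>n. real n * ln (real n)) at_top sequentially"
    by real_asymp
  show "\<forall>\<^sub>F n in sequentially. \<forall>s. 0 \<le> shuffle_tv n (k n) s \<and> shuffle_tv n (k n) s \<le> 1"
    using eventually_ge_at_top[of 1] by eventually_elim (auto simp: shuffle_tv_nonneg shuffle_tv_le_1)
next
  fix \<eta> :: real assume "0 < \<eta>"
  then have "(\<lambda>n. real n powr (- \<eta>)) \<longlonglongrightarrow> 0"
    by real_asymp
  then have "\<forall>\<^sub>F n in sequentially. real n powr (- \<eta>) < \<eta>"
    using \<open>0 < \<eta>\<close> by (rule order_tendstoD)
  then show "\<forall>\<^sub>F n in sequentially. \<forall>s. (1 + \<eta>) * (real n * ln (real n)) \<le> real s \<longrightarrow>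
    shuffle_tv n (k n) s \<le> \<eta>"
    using eventually_ge_at_top[of 2]
  proof eventually_elim
    case (elim n)
    show ?case
    proof (intro allI impI)
      fix s assume "(1 + \<eta>) * (real n * ln (real n)) \<le> real s"
      then have "shuffle_tv n (k n) s \<le> real n powr (- \<eta>)"
        using elim(2) assms(1) by (intro shuffle_tv_le_powr) auto
      with elim(1) show "shuffle_tv n (k n) s \<le> \<eta>" by linarith
    qed
  qed
next
  fix \<eta> :: real assume "0 < \<eta>"
  show "\<forall>\<^sub>F n in sequentially. \<forall>s. real s \<le> (1 - \<eta>) * (real n * ln (real n)) \<longrightarrow>
    1 - \<eta> \<le> shuffle_tv n (k n) s"
  proof (cases "\<eta> < 1")
    case False
    then have "1 - \<eta> \<le> shuffle_tv n (k n) s" for n s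
      using shuffle_tv_nonneg[of n "k n" s] by linarith
    then show ?thesis by simp
  next
    case True
    obtain \<epsilon> :: "nat \<Rightarrow> real" where \<epsilon>: "\<epsilon> \<in> o(\<lambda>_. 1)"
      and k: "\<forall>\<^sub>F n in sequentially. real (k n) = real n powr \<epsilon> n"
      using assms(2) by blast
    have "\<epsilon> \<longlonglongrightarrow> 0" using smalloD_tendsto[OF \<epsilon>] by simp
    \<comment> \<open>The bound \<open>\<eta>\<^sup>2 / 2\<close> is the part of the exponent that
      is reserved for \<open>k\<close>.\<close>
    then have "\<forall>\<^sub>F n in sequentially. \<epsilon> n < \<eta>\<^sup>2 / 2"
      using \<open>0 < \<eta>\<close> by (intro order_tendstoD) auto
    then have k_le: "\<forall>\<^sub>F n in sequentially. real (k n) \<le> real n powr (\<eta>\<^sup>2 / 2)"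
      using k eventually_ge_at_top[of 1] by eventually_elim (auto intro!: powr_mono)
    have large: "\<forall>\<^sub>F n in sequentially. 2 * sqrt (real n) \<le> \<eta> * real n"
      using \<open>0 < \<eta>\<close> by real_asymp
    have "0 < \<eta>\<^sup>2 / 2" using \<open>0 < \<eta>\<close> by simp
    \<comment> \<open>Both correction exponents tend to 0 and the power of \<open>n\<close> tends to
      infinity, so the limit is \<open>5 - 4 - 0\<close>.\<close>
    then have "(\<lambda>n. 5 - 4 * exp (16 * sqrt (real n) * ln (real n) / real n)
      - 6 / (\<eta> / 4 * real n powr (\<eta>\<^sup>2 / 2) * exp (- 8 * ln (real n) / real n))) \<longlonglongrightarrow> 1"
      using \<open>0 < \<eta>\<close> by real_asymp
    then have "\<forall>\<^sub>F n in sequentially. 1 - \<eta> < 5 - 4 * exp (16 * sqrt (real n) * ln (real n) / real n)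
      - 6 / (\<eta> / 4 * real n powr (\<eta>\<^sup>2 / 2) * exp (- 8 * ln (real n) / real n))"
      using \<open>0 < \<eta>\<close> by (intro order_tendstoD) auto
    then show ?thesis
      using k_le large eventually_ge_at_top[of 4]
    proof eventually_elim
      case (elim n)
      then have "1 \<le> k n" by (intro assms(1)) simp
      show ?case
      proof (intro allI impI)
        fix s assume "real s \<le> (1 - \<eta>) * (real n * ln (real n))"
        with elim \<open>1 \<le> k n\<close> \<open>0 < \<eta>\<close> True
        have "5 - 4 * exp (16 * sqrt (real n) * ln (real n) / real n)
          - 6 / (\<eta> / 4 * real n powr (\<eta>\<^sup>2 / 2) * exp (- 8 * ln (real n) / real n))
          \<le> shuffle_tv n (k n) s"
          by (intro shuffle_tv_ge_asymp)
        with elim(1) show "1 - \<eta> \<le> shuffle_tv n (k n) s"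
          by (meson less_imp_le order.trans)
      qed
    qed
  qed
qed

end
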